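(* Let $K$ be an algebraically closed field with $\operatorname{char} K=0$. Every three-dimensional Sklyanin algebra $S(1,1,c)$ of type EC over $K$ is isomorphic as a graded algebra to a twisted tensor product $P(a)$ of $K_{-1}[r,s]$ and $K[t]$, for some $a\in K\setminus\{0,1\}$.
   Context: Generators have degree 1 and graded isomorphisms preserve degree. For $c\in K$, $$S(1,1,c)=\frac{K\langle x,y,z\rangle}{\langle yz+zy+cx^2,\ zx+xz+cy^2,\ xy+yx+cz^2\rangle}.$$ It is a three-dimensional Sklyanin algebra of type EC (i.e. its point scheme, the zero scheme of $(2+c^3)xyz-c(x^3+y^3+z^3)$ in $\mathbb P^2$, is an elliptic curve) exactly when $c\neq0$ and $(3c)^3\neq(2+c^3)^3$. For $a\in K$, $$P(a)=\frac{K\langle r,s,t\rangle}{\langle rs+sr,\ tr+rt-t^2-ar^2,\ t(r-s)+(r-s)t+2s^2\rangle}.$$ $K_{-1}[r,s]=K\langle r,s\rangle/\langle rs+sr\rangle$. A graded twisted tensor product of graded algebras $A$ and $B$ is a graded algebra $C$ with graded algebra inclusions $i_A:A\to C$, $i_B:B\to C$ such that $a\otimes b\mapsto i_A(a)i_B(b)$ is a linear isomorphism $A\otimes B\to C$; for $P(a)$ the inclusions are the ones determined by $r\mapsto r$, $s\mapsto s$ and $t\mapsto t$. *)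

theory Defs
  imports
    "HOL-Algebra.Algebraic_Closure_Type"
    "HOL-Algebra.QuotRing"
    "HOL-Algebra.Module"
    "HOL-Library.Poly_Mapping"
    "HOL-Computational_Algebra.Polynomial"
begin

record ('k, 'a) graded_algebra = "('k, 'a) module" +
  component :: "nat \<Rightarrow> 'a set"

abbreviation scalars :: "'k::field ring" where
  "scalars \<equiv> ring_of_type_algebra"

text \<open>
  Associative unital algebras over the field \<^typ>\<open>'k\<close>, not necessarily commutative (the locale
  \<^locale>\<open>algebra\<close> requires a commutative multiplication), graded by the natural numbers.
\<close>

locale graded_algebra = module "scalars :: 'k::field ring" A + ring A
  for A :: "('k::field, 'a) graded_algebra" (structure) +
  assumes smult_mult_left:
      "\<lbrakk>x \<in> carrier A; y \<in> carrier A\<rbrakk> \<Longrightarrow> c \<odot>\<^bsub>A\<^esub> (x \<otimes>\<^bsub>A\<^esub> y) = (c \<odot>\<^bsub>A\<^esub> x) \<otimes>\<^bsub>A\<^esub> y"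
    and smult_mult_right:
      "\<lbrakk>x \<in> carrier A; y \<in> carrier A\<rbrakk> \<Longrightarrow> c \<odot>\<^bsub>A\<^esub> (x \<otimes>\<^bsub>A\<^esub> y) = x \<otimes>\<^bsub>A\<^esub> (c \<odot>\<^bsub>A\<^esub> y)"
    and component_submodule: "submodule (component A n) (scalars :: 'k ring) A"
    and one_component: "\<one>\<^bsub>A\<^esub> \<in> component A 0"
    and mult_component:
      "\<lbrakk>x \<in> component A m; y \<in> component A n\<rbrakk> \<Longrightarrow> x \<otimes>\<^bsub>A\<^esub> y \<in> component A (m + n)"
    and direct_sum:
      "x \<in> carrier A \<Longrightarrow>
        \<exists>!f :: nat \<Rightarrow> 'a. (\<forall>n. f n \<in> component A n) \<and> finite {n. f n \<noteq> \<zero>\<^bsub>A\<^esub>} \<and>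
          x = (\<Oplus>\<^bsub>A\<^esub>n\<in>{n. f n \<noteq> \<zero>\<^bsub>A\<^esub>}. f n)"

definition graded_algebra_hom ::
    "('k, 'a) graded_algebra \<Rightarrow> ('k, 'b) graded_algebra \<Rightarrow> ('a \<Rightarrow> 'b) set" where
  "graded_algebra_hom A B =
    {f \<in> ring_hom A B.
      (\<forall>c. \<forall>x\<in>carrier A. f (c \<odot>\<^bsub>A\<^esub> x) = c \<odot>\<^bsub>B\<^esub> f x) \<and>
      (\<forall>n. f ` component A n \<subseteq> component B n)}"

definition graded_algebra_inclusion ::
    "('k, 'a) graded_algebra \<Rightarrow> ('k, 'b) graded_algebra \<Rightarrow> ('a \<Rightarrow> 'b) \<Rightarrow> bool" where
  "graded_algebra_inclusion A B f \<longleftrightarrow> f \<in> graded_algebra_hom A B \<and> inj_on f (carrier A)"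

definition graded_isomorphic ::
    "('k, 'a) graded_algebra \<Rightarrow> ('k, 'b) graded_algebra \<Rightarrow> bool" where
  "graded_isomorphic A B \<longleftrightarrow>
    (\<exists>f \<in> graded_algebra_hom A B. bij_betw f (carrier A) (carrier B))"

text \<open>
  Vector spaces are represented by \<^typ>\<open>('k, 'a) module\<close> records, whose fields
  \<^const>\<open>monoid.mult\<close> and \<^const>\<open>one\<close> are irrelevant and left unspecified.
\<close>

definition free_space :: "'x set \<Rightarrow> ('k::field, 'x \<Rightarrow>\<^sub>0 'k) module" where
  "free_space V =
    \<lparr>carrier = {p. Poly_Mapping.keys p \<subseteq> V}, monoid.mult = undefined, one = undefined,
     zero = 0, add = (+), module.smult = (\<lambda>c. Poly_Mapping.map ((*) c))\<rparr>"

definition generated_submodule :: "('k::field, 'a, 'm) module_scheme \<Rightarrow> 'a set \<Rightarrow> 'a set" where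
  "generated_submodule M S = \<Inter>{N. submodule N (scalars :: 'k ring) M \<and> S \<subseteq> N}"

text \<open>
  The summand \<^term>\<open>N\<close> is needed for the scalar \<open>0\<close>: it turns the image \<open>{0}\<close> of a coset
  into the coset \<^term>\<open>N\<close>.
\<close>

definition coset_smult :: "('k, 'a, 'm) module_scheme \<Rightarrow> 'a set \<Rightarrow> 'k \<Rightarrow> 'a set \<Rightarrow> 'a set" where
  "coset_smult M N c V = N <+>\<^bsub>M\<^esub> ((\<lambda>x. c \<odot>\<^bsub>M\<^esub> x) ` V)"

definition quotient_space :: "('k, 'a, 'm) module_scheme \<Rightarrow> 'a set \<Rightarrow> ('k, 'a set) module" where
  "quotient_space M N =
    \<lparr>carrier = a_rcosets\<^bsub>M\<^esub> N, monoid.mult = undefined, one = undefined,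
     zero = N, add = set_add M, module.smult = coset_smult M N\<rparr>"

definition tensor_relations ::
    "('k::field, 'a, 'm) module_scheme \<Rightarrow> ('k, 'b, 'n) module_scheme \<Rightarrow> (('a \<times> 'b) \<Rightarrow>\<^sub>0 'k) set" where
  "tensor_relations A B =
    {Poly_Mapping.single (a \<oplus>\<^bsub>A\<^esub> a', b) 1 - Poly_Mapping.single (a, b) 1
        - Poly_Mapping.single (a', b) 1 | a a' b.
      a \<in> carrier A \<and> a' \<in> carrier A \<and> b \<in> carrier B} \<union>
    {Poly_Mapping.single (a, b \<oplus>\<^bsub>B\<^esub> b') 1 - Poly_Mapping.single (a, b) 1
        - Poly_Mapping.single (a, b') 1 | a b b'.
      a \<in> carrier A \<and> b \<in> carrier B \<and> b' \<in> carrier B} \<union>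
    {Poly_Mapping.single (c \<odot>\<^bsub>A\<^esub> a, b) 1 - Poly_Mapping.single (a, b) c | c a b.
      a \<in> carrier A \<and> b \<in> carrier B} \<union>
    {Poly_Mapping.single (a, c \<odot>\<^bsub>B\<^esub> b) 1 - Poly_Mapping.single (a, b) c | c a b.
      a \<in> carrier A \<and> b \<in> carrier B}"

definition tensor_null ::
    "('k::field, 'a, 'm) module_scheme \<Rightarrow> ('k, 'b, 'n) module_scheme \<Rightarrow> (('a \<times> 'b) \<Rightarrow>\<^sub>0 'k) set" where
  "tensor_null A B =
    generated_submodule (free_space (carrier A \<times> carrier B)) (tensor_relations A B)"

definition tensor_product ::
    "('k::field, 'a, 'm) module_scheme \<Rightarrow> ('k, 'b, 'n) module_scheme \<Rightarrow>
      ('k, (('a \<times> 'b) \<Rightarrow>\<^sub>0 'k) set) module" where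
  "tensor_product A B =
    quotient_space (free_space (carrier A \<times> carrier B)) (tensor_null A B)"

definition pure_tensor ::
    "('k::field, 'a, 'm) module_scheme \<Rightarrow> ('k, 'b, 'n) module_scheme \<Rightarrow> 'a \<Rightarrow> 'b \<Rightarrow>
      (('a \<times> 'b) \<Rightarrow>\<^sub>0 'k) set" where
  "pure_tensor A B a b =
    tensor_null A B +>\<^bsub>free_space (carrier A \<times> carrier B)\<^esub> Poly_Mapping.single (a, b) 1"

definition linear_iso ::
    "('k, 'a, 'm) module_scheme \<Rightarrow> ('k, 'b, 'n) module_scheme \<Rightarrow> ('a \<Rightarrow> 'b) \<Rightarrow> bool" where
  "linear_iso M N f \<longleftrightarrow>
    bij_betw f (carrier M) (carrier N) \<and>
    (\<forall>x\<in>carrier M. \<forall>y\<in>carrier M. f (x \<oplus>\<^bsub>M\<^esub> y) = f x \<oplus>\<^bsub>N\<^esub> f y) \<and>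
    (\<forall>c. \<forall>x\<in>carrier M. f (c \<odot>\<^bsub>M\<^esub> x) = c \<odot>\<^bsub>N\<^esub> f x)"

definition graded_twisted_tensor_product ::
    "('k::field, 'a) graded_algebra \<Rightarrow> ('k, 'b) graded_algebra \<Rightarrow> ('k, 'c) graded_algebra \<Rightarrow>
      ('a \<Rightarrow> 'c) \<Rightarrow> ('b \<Rightarrow> 'c) \<Rightarrow> bool" where
  "graded_twisted_tensor_product A B C iA iB \<longleftrightarrow>
    graded_algebra A \<and> graded_algebra B \<and> graded_algebra C \<and>
    graded_algebra_inclusion A C iA \<and> graded_algebra_inclusion B C iB \<and>
    (\<exists>\<phi>. linear_iso (tensor_product A B) C \<phi> \<and>
      (\<forall>a\<in>carrier A. \<forall>b\<in>carrier B. \<phi> (pure_tensor A B a b) = iA a \<otimes>\<^bsub>C\<^esub> iB b))"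

datatype 'g word = Word (letters: "'g list")

instantiation word :: (type) monoid_add
begin

definition zero_word :: "'g word" where
  "zero_word = Word []"

definition plus_word :: "'g word \<Rightarrow> 'g word \<Rightarrow> 'g word" where
  "plus_word u v = Word (letters u @ letters v)"

instance
  by standard (simp_all add: zero_word_def plus_word_def)

end

text \<open>
  The free algebra is the monoid algebra of the free monoid. The monoid is written additively
  because the convolution product of \<^theory>\<open>HOL-Library.Poly_Mapping\<close> requires
  \<^class>\<open>monoid_add\<close>; concatenation is not commutative.
\<close>

type_synonym ('g, 'k) free_alg = "'g word \<Rightarrow>\<^sub>0 'k"

definition gen :: "'g \<Rightarrow> ('g, 'k::field) free_alg" where
  "gen g = Poly_Mapping.single (Word [g]) 1"

definition scalar :: "'k::field \<Rightarrow> ('g, 'k) free_alg" where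
  "scalar c = Poly_Mapping.single 0 c"

definition free_algebra :: "('k::field, ('g, 'k) free_alg) graded_algebra" where
  "free_algebra =
    \<lparr>carrier = UNIV, monoid.mult = (*), one = 1, zero = 0, add = (+),
     module.smult = (\<lambda>c p. scalar c * p),
     component = (\<lambda>n. {p. \<forall>w\<in>Poly_Mapping.keys p. length (letters w) = n})\<rparr>"

definition graded_quotient ::
    "('k, 'a) graded_algebra \<Rightarrow> 'a set \<Rightarrow> ('k, 'a set) graded_algebra" where
  "graded_quotient A I =
    \<lparr>carrier = carrier (A Quot I), monoid.mult = monoid.mult (A Quot I), one = one (A Quot I),
     zero = zero (A Quot I), add = add (A Quot I), module.smult = coset_smult A I,
     component = (\<lambda>n. (\<lambda>x. I +>\<^bsub>A\<^esub> x) ` component A n)\<rparr>"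

definition presented_algebra ::
    "('g, 'k::field) free_alg set \<Rightarrow> ('k, ('g, 'k) free_alg set) graded_algebra" where
  "presented_algebra rels = graded_quotient free_algebra (Idl\<^bsub>free_algebra\<^esub> rels)"

definition gen_class ::
    "('g, 'k::field) free_alg set \<Rightarrow> 'g \<Rightarrow> ('g, 'k) free_alg set" where
  "gen_class rels g = Idl\<^bsub>free_algebra\<^esub> rels +>\<^bsub>free_algebra\<^esub> gen g"

definition polynomial_algebra :: "('k::field, 'k poly) graded_algebra" where
  "polynomial_algebra =
    \<lparr>carrier = UNIV, monoid.mult = (*), one = 1, zero = 0, add = (+),
     module.smult = Polynomial.smult,
     component = (\<lambda>n. range (\<lambda>c. Polynomial.monom c n))\<rparr>"

datatype xyz = Gen_x | Gen_y | Gen_z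

definition S11_relations :: "'k::field \<Rightarrow> (xyz, 'k) free_alg set" where
  "S11_relations c =
    (let x = gen Gen_x; y = gen Gen_y; z = gen Gen_z in
      {y * z + z * y + scalar c * x ^ 2,
       z * x + x * z + scalar c * y ^ 2,
       x * y + y * x + scalar c * z ^ 2})"

definition S11_algebra :: "'k::field \<Rightarrow> ('k, (xyz, 'k) free_alg set) graded_algebra" where
  "S11_algebra c = presented_algebra (S11_relations c)"

datatype rst = Gen_r | Gen_s | Gen_t

definition P_relations :: "'k::field \<Rightarrow> (rst, 'k) free_alg set" where
  "P_relations a =
    (let r = gen Gen_r; s = gen Gen_s; t = gen Gen_t in
      {r * s + s * r,
       t * r + r * t - t ^ 2 - scalar a * r ^ 2,
       t * (r - s) + (r - s) * t + scalar 2 * s ^ 2})"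

definition P_algebra :: "'k::field \<Rightarrow> ('k, (rst, 'k) free_alg set) graded_algebra" where
  "P_algebra a = presented_algebra (P_relations a)"

datatype rs = Skew_r | Skew_s

definition skew_relations :: "(rs, 'k::field) free_alg set" where
  "skew_relations = {gen Skew_r * gen Skew_s + gen Skew_s * gen Skew_r}"

definition skew_polynomial_algebra :: "('k::field, (rs, 'k) free_alg set) graded_algebra" where
  "skew_polynomial_algebra = presented_algebra skew_relations"

text \<open>
  \<^term>\<open>P_algebra a\<close> is a graded twisted tensor product with respect to the inclusions determined by
  \<open>r \<mapsto> r\<close>, \<open>s \<mapsto> s\<close> and \<open>t \<mapsto> t\<close>. Since \<open>r, s\<close> and \<open>t\<close> generate the factors, at most one
  pair of homomorphisms satisfies these conditions (up to values outside the carriers).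
\<close>

definition P_is_twisted_tensor_product :: "'k::field \<Rightarrow> bool" where
  "P_is_twisted_tensor_product a \<longleftrightarrow>
    (\<exists>iA iB.
      iA (gen_class skew_relations Skew_r) = gen_class (P_relations a) Gen_r \<and>
      iA (gen_class skew_relations Skew_s) = gen_class (P_relations a) Gen_s \<and>
      iB (Polynomial.monom 1 1) = gen_class (P_relations a) Gen_t \<and>
      graded_twisted_tensor_product skew_polynomial_algebra polynomial_algebra (P_algebra a) iA iB)"

text \<open>
  Writing the relations of \<^term>\<open>S11_algebra c\<close> as \<open>M (x, y, z)\<^sup>T\<close>, the point scheme is
  the zero scheme of \<open>det M\<close> (in commuting variables), which is the following ternary cubic.
  It is defined over an arbitrary commutative ring so that its partial derivatives can be taken with \<^const>\<open>pderiv\<close>.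
\<close>

definition point_cubic :: "'a::comm_ring_1 \<Rightarrow> 'a \<Rightarrow> 'a \<Rightarrow> 'a \<Rightarrow> 'a" where
  "point_cubic c x y z = (2 + c ^ 3) * x * y * z - c * (x ^ 3 + y ^ 3 + z ^ 3)"

definition point_cubic_dx :: "'k::field \<Rightarrow> 'k \<Rightarrow> 'k \<Rightarrow> 'k \<Rightarrow> 'k" where
  "point_cubic_dx c x y z = poly (pderiv (point_cubic [:c:] [:0, 1:] [:y:] [:z:])) x"

definition point_cubic_dy :: "'k::field \<Rightarrow> 'k \<Rightarrow> 'k \<Rightarrow> 'k \<Rightarrow> 'k" where
  "point_cubic_dy c x y z = poly (pderiv (point_cubic [:c:] [:x:] [:0, 1:] [:z:])) y"

definition point_cubic_dz :: "'k::field \<Rightarrow> 'k \<Rightarrow> 'k \<Rightarrow> 'k \<Rightarrow> 'k" where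
  "point_cubic_dz c x y z = poly (pderiv (point_cubic [:c:] [:x:] [:y:] [:0, 1:])) z"

text \<open>
  Over an algebraically closed field, the zero scheme in \<open>\<bbbP>\<^sup>2\<close> of a ternary cubic is an elliptic
  curve iff it is smooth, i.e. no point of it satisfies the Jacobian condition for being singular.
  This covers the zero cubic, all of whose points are singular.
\<close>

definition type_EC :: "'k::alg_closed_field \<Rightarrow> bool" where
  "type_EC c \<longleftrightarrow>
    \<not> (\<exists>x y z. (x, y, z) \<noteq> (0, 0, 0) \<and> point_cubic c x y z = 0 \<and>
      point_cubic_dx c x y z = 0 \<and> point_cubic_dy c x y z = 0 \<and> point_cubic_dz c x y z = 0)"

lemma point_cubic_partials:
  "point_cubic_dx c x y z = (2 + c ^ 3) * y * z - 3 * c * x ^ 2"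
  "point_cubic_dy c x y z = (2 + c ^ 3) * x * z - 3 * c * y ^ 2"
  "point_cubic_dz c x y z = (2 + c ^ 3) * x * y - 3 * c * z ^ 2"
  by (simp_all add: point_cubic_dx_def point_cubic_dy_def point_cubic_dz_def point_cubic_def
      pderiv_add pderiv_diff pderiv_mult pderiv_pCons pderiv_power numeral_poly power2_eq_square power3_eq_cube
      algebra_simps)

lemma type_EC_iff:
  fixes c :: "'k::{alg_closed_field, field_char_0}"
  shows "type_EC c \<longleftrightarrow> c \<noteq> 0 \<and> (3 * c) ^ 3 \<noteq> (2 + c ^ 3) ^ 3"
proof
  assume ec: "type_EC c"
  have c0: "c \<noteq> 0"
  proof
    assume "c = 0"
    then have "point_cubic c 1 0 0 = 0" "point_cubic_dx c 1 0 0 = 0" "point_cubic_dy c 1 0 0 = 0"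
        "point_cubic_dz c 1 0 0 = 0"
      by (simp_all add: point_cubic_partials point_cubic_def)
    with ec show False
      unfolding type_EC_def by (metis prod.inject zero_neq_one)
  qed
  moreover have "(3 * c) ^ 3 \<noteq> (2 + c ^ 3) ^ 3"
  proof
    define m where "m = 2 + c ^ 3"
    define z where "z = 3 * c / m"
    assume "(3 * c) ^ 3 = (2 + c ^ 3) ^ 3"
    then have eq: "(3 * c) ^ 3 = m ^ 3"
      by (simp add: m_def)
    with c0 have m0: "m \<noteq> 0"
      by auto
    have mz: "m * z = 3 * c"
      using m0 by (simp add: z_def)
    have z3: "z ^ 3 = 1"
      using eq m0 by (simp add: z_def power_divide)
    have "3 * c * z ^ 2 = m * z ^ 3"
      by (simp add: mz [symmetric] power2_eq_square power3_eq_cube)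
    then have mz2: "3 * c * z ^ 2 = m"
      by (simp add: z3)
    have "point_cubic c 1 1 z = 0" "point_cubic_dx c 1 1 z = 0" "point_cubic_dy c 1 1 z = 0"
        "point_cubic_dz c 1 1 z = 0"
      using mz mz2 by (simp_all add: point_cubic_partials point_cubic_def z3 flip: m_def)
    with ec show False
      unfolding type_EC_def by (metis prod.inject zero_neq_one)
  qed
  ultimately show "c \<noteq> 0 \<and> (3 * c) ^ 3 \<noteq> (2 + c ^ 3) ^ 3" ..
next
  assume c: "c \<noteq> 0 \<and> (3 * c) ^ 3 \<noteq> (2 + c ^ 3) ^ 3"
  show "type_EC c"
    unfolding type_EC_def
  proof (rule notI, elim exE conjE)
    fix x y z :: 'k
    define m where "m = 2 + c ^ 3"
    assume nz: "(x, y, z) \<noteq> (0, 0, 0)"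
    assume "point_cubic_dx c x y z = 0" "point_cubic_dy c x y z = 0" "point_cubic_dz c x y z = 0"
    then have e: "m * y * z = 3 * c * x ^ 2" "m * x * z = 3 * c * y ^ 2" "m * x * y = 3 * c * z ^ 2"
      by (simp_all add: point_cubic_partials m_def)
    have "(m * y * z) * (m * x * z) * (m * x * y) = (3 * c * x ^ 2) * (3 * c * y ^ 2) * (3 * c * z ^ 2)"
      by (simp only: e)
    then have "(m ^ 3 - (3 * c) ^ 3) * (x * y * z) ^ 2 = 0"
      by (simp add: power2_eq_square power3_eq_cube algebra_simps)
    moreover have "m ^ 3 - (3 * c) ^ 3 \<noteq> 0"
      using c by (auto simp: m_def)
    ultimately have "x * y * z = 0"
      by simp
    then have "x = 0 \<and> y = 0 \<and> z = 0"
      using e c by auto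
    with nz show False
      by simp
  qed
qed

end

theory Submission
  imports Defs
begin

text \<open>
  The relations of both algebras are symmetric tensors, so replacing the tensor \<open>u v + v u\<close> by
  \<open>2 u v\<close> turns them into nets of conics, and a linear change of variables that matches
  the nets is a graded isomorphism. The conics of \<open>S(1,1,c)\<close> are the partial derivatives of
  the Hesse cubic \<open>c (x\<^sup>3 + y\<^sup>3 + z\<^sup>3) + 6 x y z\<close>. Those of \<open>P(a)\<close>,
  for \<open>a \<noteq> 1\<close>, are spanned by the partial derivatives of
  \<open>w (t - s)\<^sup>2 + w\<^sup>3 / 3 + (a - 1) r\<^sup>2 w + 2 (a - 1) r\<^sup>3 / 3\<close> with
  \<open>w = s - r\<close>, which is a Weierstrass cubic: \<open>w = 0\<close> is the tangent at a flex,
  \<open>t = s\<close> is the corresponding harmonic polar, and the binary cubic in \<open>r, w\<close> is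
  normalised to have its critical points at \<open>r / w = 0\<close> and \<open>r / w = - 1\<close>.

  The Hesse cubic is brought to this form at the flex \<open>(1 : - 1 : 0)\<close>, with tangent
  \<open>c (x + y) = 2 z\<close> and harmonic polar \<open>x = y\<close>. Two square roots are needed. A root
  \<open>e\<close> of \<open>1 - c\<^sup>3\<close> gives the two critical points, and \<open>e \<noteq> 0\<close>
  says that they are distinct (the \<open>j\<close>-invariant of the cubic is not \<open>0\<close>); a root \<open>d\<close> of
  \<open>- (3 - e) (1 + e)\<close> rescales \<open>x - y\<close>. The resulting parameter is
  \<open>a = (3 + e)\<^sup>3 (1 - e) / ((3 - e)\<^sup>3 (1 + e))\<close>, and
  \<open>(3 c)\<^sup>3 - (2 + c\<^sup>3)\<^sup>3 = e\<^sup>4 (e\<^sup>2 - 9)\<close>, so type EC says precisely that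
  \<open>e\<close> avoids \<open>0, 1, - 1, 3, - 3\<close>. This part is carried by
  \<open>subst_S_rel\<close>, \<open>S11_P_isomorphic\<close> and \<open>type_EC_parameters\<close>.

  That \<open>P(a)\<close> is a twisted tensor product for every \<open>a \<noteq> 1\<close> means that the monomials
  \<open>r\<^sup>i s\<^sup>j t\<^sup>k\<close> form a basis of it. The rewriting of \<open>t r\<close> to
  \<open>- r t + t\<^sup>2 + a r\<^sup>2\<close> does not terminate, because \<open>t\<^sup>2 r\<close> reproduces itself
  with coefficient \<open>a\<close>. But if \<open>a \<noteq> 1\<close>, then it can be solved for
  \<open>t\<^sup>2 r\<close>, and it follows that \<open>r\<^sup>2\<close>, \<open>s\<^sup>2\<close> and
  \<open>t\<^sup>2\<close> are central. Hence \<open>P(a)\<close> is the Clifford algebra of a quadratic form over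
  \<open>K[r\<^sup>2, s\<^sup>2, t\<^sup>2]\<close>, which is free with basis \<open>r\<^sup>i s\<^sup>j t\<^sup>k\<close> for
  \<open>i, j, k \<le> 1\<close>. The lemma \<open>P_straighten\<close> shows that the monomials span; they are
  independent because \<open>P(a)\<close> acts on the space with basis \<open>\<nat>\<^sup>3\<close> by the formulas
  of left multiplication (\<open>P_op_relations\<close>). Finally, \<open>tensor_product_iso_if_basis\<close>
  passes from bases to the tensor product.
\<close>



section \<open>Linear maps between spaces of finitely supported functions\<close>

definition pscale :: "'k::field \<Rightarrow> ('a \<Rightarrow>\<^sub>0 'k) \<Rightarrow> ('a \<Rightarrow>\<^sub>0 'k)" where
  "pscale c = Poly_Mapping.map ((*) c)"

lemma lookup_pscale [simp]: "Poly_Mapping.lookup (pscale c p) x = c * Poly_Mapping.lookup p x"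
  unfolding pscale_def by transfer (simp add: when_def)

lemma pscale_single [simp]: "pscale c (Poly_Mapping.single a d) = Poly_Mapping.single a (c * d)"
  by (simp add: pscale_def)

lemma scalar_times: "scalar c * p = pscale c p"
  by (simp add: scalar_def pscale_def mult_map_scale_conv_mult)

interpretation pscale: Modules.module pscale
  by standard (auto intro!: poly_mapping_eqI simp: lookup_add algebra_simps)

interpretation pscale_pair: module_pair pscale pscale ..

abbreviation lin :: "(('a \<Rightarrow>\<^sub>0 'k::field) \<Rightarrow> ('b \<Rightarrow>\<^sub>0 'k)) \<Rightarrow> bool" where
  "lin \<equiv> module_hom pscale pscale"

lemma linI:
  "(\<And>x y. f (x + y) = f x + f y) \<Longrightarrow> (\<And>c x. f (pscale c x) = pscale c (f x)) \<Longrightarrow> lin f"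
  by (simp add: module_hom_iff pscale.module_axioms)

lemmas lin_add = module_hom.add
  and lin_scale = module_hom.scale
  and lin_zero = module_hom.zero
  and lin_minus = module_hom.neg
  and lin_diff = module_hom.diff
  and lin_sum = module_hom.sum

lemma lin_id: "lin (\<lambda>x. x)"
  and lin_comp: "lin f \<Longrightarrow> lin g \<Longrightarrow> lin (\<lambda>x. g (f x))"
  using module_hom_compose [of pscale pscale f pscale g] by (auto intro: linI simp: o_def)

lemma single_eq_pscale: "Poly_Mapping.single a c = pscale c (Poly_Mapping.single a 1)"
  by simp

lemma poly_mapping_sum_single:
  "(p :: 'a \<Rightarrow>\<^sub>0 'b::comm_monoid_add) = (\<Sum>a\<in>Poly_Mapping.keys p. Poly_Mapping.single a (Poly_Mapping.lookup p a))"
  by (rule poly_mapping_eqI)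
    (auto simp: lookup_sum lookup_single when_def in_keys_iff if_distrib sum.delta cong: if_cong)

lemma poly_mapping_linear_induct [case_names zero single add]:
  fixes P :: "('a \<Rightarrow>\<^sub>0 'b::comm_monoid_add) \<Rightarrow> bool"
  assumes "P 0" "\<And>a c. P (Poly_Mapping.single a c)" "\<And>p q. P p \<Longrightarrow> P q \<Longrightarrow> P (p + q)"
  shows "P p"
proof -
  have "P (\<Sum>a\<in>A. Poly_Mapping.single a (Poly_Mapping.lookup p a))" if "finite A" for A
    using that by induction (auto intro: assms)
  then show ?thesis
    using poly_mapping_sum_single [of p] by (metis finite_keys)
qed

lemma lin_eqI:
  assumes "lin f" "lin g" and "\<And>a. f (Poly_Mapping.single a 1) = g (Poly_Mapping.single a 1)"
  shows "f p = g p"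
proof (induction p rule: poly_mapping_linear_induct)
  case (single a c)
  show ?case
    by (subst (1 2) single_eq_pscale) (simp only: lin_scale [OF assms(1)] lin_scale [OF assms(2)] assms(3))
qed (simp_all add: lin_add [OF assms(1)] lin_add [OF assms(2)] lin_zero [OF assms(1)] lin_zero [OF assms(2)])

definition lin_ext :: "('a \<Rightarrow> ('b \<Rightarrow>\<^sub>0 'k::field)) \<Rightarrow> ('a \<Rightarrow>\<^sub>0 'k) \<Rightarrow> ('b \<Rightarrow>\<^sub>0 'k)" where
  "lin_ext F p = (\<Sum>a\<in>Poly_Mapping.keys p. pscale (Poly_Mapping.lookup p a) (F a))"

lemma lin_ext_superset:
  assumes "finite A" "Poly_Mapping.keys p \<subseteq> A"
  shows "lin_ext F p = (\<Sum>a\<in>A. pscale (Poly_Mapping.lookup p a) (F a))"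
  unfolding lin_ext_def using assms by (intro sum.mono_neutral_left) (auto simp: in_keys_iff)

lemma lin_lin_ext: "lin (lin_ext (F :: 'a \<Rightarrow> ('c \<Rightarrow>\<^sub>0 'b::field)))"
proof (rule linI)
  fix p q :: "'a \<Rightarrow>\<^sub>0 'b" and c :: 'b
  let ?A = "Poly_Mapping.keys p \<union> Poly_Mapping.keys q"
  have "Poly_Mapping.keys (p + q) \<subseteq> ?A"
    by (rule keys_add)
  then show "lin_ext F (p + q) = lin_ext F p + lin_ext F q"
    by (simp add: lin_ext_superset [of ?A] lookup_add pscale.scale_left_distrib sum.distrib)
  have "Poly_Mapping.keys (pscale c p) \<subseteq> Poly_Mapping.keys p"
    by (auto simp: in_keys_iff)
  then show "lin_ext F (pscale c p) = pscale c (lin_ext F p)"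
    by (simp add: lin_ext_superset [of "Poly_Mapping.keys p"] pscale.scale_sum_right)
qed

lemma lin_ext_single [simp]: "lin_ext F (Poly_Mapping.single a c) = pscale c (F a)"
  by (simp add: lin_ext_def)

lemma lin_ext_in_subspace: "pscale.subspace S \<Longrightarrow> (\<And>a. F a \<in> S) \<Longrightarrow> lin_ext F p \<in> S"
  by (simp add: lin_ext_def pscale.subspace_sum pscale.subspace_scale)

section \<open>Free algebras\<close>

lemma pscale_mult_left: "pscale c (p * q) = pscale c p * (q :: ('g, 'k::field) free_alg)"
  by (simp add: mult.assoc flip: scalar_times)

lemma scalar_central: "p * scalar c = scalar c * (p :: ('g, 'k::field) free_alg)"
  by (induction p rule: poly_mapping_linear_induct)
     (simp_all add: scalar_def mult_single algebra_simps)

lemma pscale_mult_right: "pscale c (p * q) = p * pscale c (q :: ('g, 'k::field) free_alg)"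
  by (simp add: scalar_central flip: scalar_times mult.assoc)

lemma lin_mult_left: "lin (\<lambda>q. p * q)" and lin_mult_right: "lin (\<lambda>q. q * p)"
  for p :: "('g, 'k::field) free_alg"
  by (rule linI [of "\<lambda>q. p * q"], simp_all only: distrib_left pscale_mult_right)
    (rule linI [of "\<lambda>q. q * p"], simp_all only: distrib_right pscale_mult_left)

lemma letters_add [simp]: "letters (u + v) = letters u @ letters v"
  and letters_zero [simp]: "letters 0 = []"
  by (simp_all add: plus_word_def zero_word_def)

definition subst :: "('g \<Rightarrow> ('h, 'k::field) free_alg) \<Rightarrow> ('g, 'k) free_alg \<Rightarrow> ('h, 'k) free_alg" where
  "subst h = lin_ext (\<lambda>w. prod_list (map h (letters w)))"

lemma lin_subst: "lin (subst h)"
  by (simp add: subst_def lin_lin_ext)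

lemma subst_gen [simp]: "subst h (gen g) = h g"
  by (simp add: subst_def gen_def)

lemma subst_one [simp]: "subst h 1 = 1"
  by (simp add: subst_def flip: single_one)

lemma subst_mult: "subst h (p * q) = subst h p * subst h q"
proof -
  note lin_comps = lin_comp [of "\<lambda>q. p * q" "subst h" for p] lin_comp [of "subst h" "\<lambda>q. p * q" for p]
    lin_comp [of "\<lambda>q. q * p" "subst h" for p] lin_comp [of "subst h" "\<lambda>q. q * p" for p]
  have *: "subst h (Poly_Mapping.single u 1 * q) = subst h (Poly_Mapping.single u 1) * subst h q" for u
  proof (rule lin_eqI [of "\<lambda>q. subst h (Poly_Mapping.single u 1 * q)"
          "\<lambda>q. subst h (Poly_Mapping.single u 1) * subst h q"])
    show "subst h (Poly_Mapping.single u 1 * Poly_Mapping.single v 1) =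
        subst h (Poly_Mapping.single u 1) * subst h (Poly_Mapping.single v 1)" for v
      by (simp add: mult_single, simp add: subst_def)
  qed (rule lin_comps lin_subst lin_mult_left)+
  show ?thesis
    by (rule lin_eqI [of "\<lambda>p. subst h (p * q)" "\<lambda>p. subst h p * subst h q"])
      (rule lin_comps lin_subst lin_mult_right *)+
qed

lemma subst_power: "subst h (p ^ n) = subst h p ^ n"
  by (induction n) (simp_all add: subst_mult)

lemmas subst_add = lin_add [OF lin_subst]
  and subst_diff = lin_diff [OF lin_subst]
  and subst_pscale = lin_scale [OF lin_subst]

lemma subst_subst: "subst h (subst h' p) = subst (\<lambda>g. subst h (h' g)) p"
proof (rule lin_eqI [of "\<lambda>p. subst h (subst h' p)" "\<lambda>p. subst (\<lambda>g. subst h (h' g)) p"])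
  fix w
  have "subst h (prod_list (map h' ws)) = prod_list (map (\<lambda>g. subst h (h' g)) ws)" for ws
    by (induction ws) (simp_all add: subst_mult)
  then show "subst h (subst h' (Poly_Mapping.single w 1)) = subst (\<lambda>g. subst h (h' g)) (Poly_Mapping.single w 1)"
    by (simp add: subst_def [of h'] subst_def [of "\<lambda>g. subst h (h' g)"])
qed (rule lin_comp [of "subst h'" "subst h"] lin_subst)+

lemma single_Word: "Poly_Mapping.single w (1 :: 'k::field) = prod_list (map gen (letters w))"
proof (cases w)
  case (Word ws)
  have "Poly_Mapping.single (Word ws) (1 :: 'k) = prod_list (map gen ws)"
  proof (induction ws)
    case Nil
    then show ?case
      by (simp add: flip: single_one zero_word_def)
  next
    case (Cons g ws)
    have "Poly_Mapping.single (Word (g # ws)) (1 :: 'k) = gen g * Poly_Mapping.single (Word ws) 1"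
      by (simp add: gen_def mult_single plus_word_def)
    then show ?case
      by (simp add: Cons.IH)
  qed
  then show ?thesis
    by (simp add: Word)
qed

lemma subst_gens [simp]: "subst gen p = p"
  by (rule lin_eqI [of "subst gen" "\<lambda>p. p"])
    (simp_all add: lin_subst lin_id, simp add: subst_def flip: single_Word)

text \<open>
  The free algebra acts on a space as soon as each generator acts by a linear map.
\<close>
definition act ::
    "('g \<Rightarrow> ('b \<Rightarrow>\<^sub>0 'k) \<Rightarrow> ('b \<Rightarrow>\<^sub>0 'k)) \<Rightarrow> ('g, 'k::field) free_alg \<Rightarrow> ('b \<Rightarrow>\<^sub>0 'k) \<Rightarrow> ('b \<Rightarrow>\<^sub>0 'k)" where
  "act T p v = lin_ext (\<lambda>w. foldr T (letters w) v) p"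

lemma lin_act_left: "lin (\<lambda>p. act T p v)"
  by (simp add: act_def lin_lin_ext)

lemma act_gen [simp]: "act T (gen g) v = T g v"
  by (simp add: act_def gen_def)

lemma act_one [simp]: "act T 1 v = v"
  by (simp add: act_def flip: single_one)

lemma lin_act_right:
  assumes "\<And>g. lin (T g)"
  shows "lin (act T p)"
proof -
  have *: "lin (foldr T ws)" for ws
    by (induction ws) (simp_all add: id_def lin_id o_def lin_comp [OF _ assms])
  show ?thesis
    by (rule linI)
      (simp_all add: act_def lin_ext_def lin_add [OF *] lin_scale [OF *] pscale.scale_right_distrib
        sum.distrib pscale.scale_sum_right mult.commute)
qed

lemma act_mult:
  assumes T: "\<And>g. lin (T g)"
  shows "act T (p * q) v = act T p (act T q v)"
proof -
  have *: "act T (Poly_Mapping.single u 1 * q) v = act T (Poly_Mapping.single u 1) (act T q v)" for u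
  proof (rule lin_eqI [of "\<lambda>q. act T (Poly_Mapping.single u 1 * q) v"
        "\<lambda>q. act T (Poly_Mapping.single u 1) (act T q v)"])
    show "act T (Poly_Mapping.single u 1 * Poly_Mapping.single w 1) v =
        act T (Poly_Mapping.single u 1) (act T (Poly_Mapping.single w 1) v)" for w
      by (simp add: mult_single, simp add: act_def)
    show "lin (\<lambda>q. act T (Poly_Mapping.single u 1 * q) v)"
      by (rule lin_comp [OF lin_mult_left lin_act_left])
    show "lin (\<lambda>q. act T (Poly_Mapping.single u 1) (act T q v))"
      by (rule lin_comp [OF lin_act_left lin_act_right [OF T]])
  qed
  show ?thesis
    by (rule lin_eqI [of "\<lambda>p. act T (p * q) v" "\<lambda>p. act T p (act T q v)"])
      (rule lin_comp [OF lin_mult_right lin_act_left] lin_act_left *)+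
qed

lemmas act_add = lin_add [OF lin_act_left]

section \<open>Ideals of relations and cosets\<close>

lemma free_algebra_simps [simp]:
  "carrier free_algebra = UNIV" "monoid.mult free_algebra = (*)" "one free_algebra = 1"
  "zero free_algebra = 0" "add free_algebra = (+)" "module.smult free_algebra = pscale"
  by (simp_all add: free_algebra_def scalar_times)

lemma free_algebra_ring: "ring (free_algebra :: ('k::field, ('g, 'k) free_alg) graded_algebra)"
proof (rule ringI)
  show "abelian_group (free_algebra :: ('k::field, ('g, 'k) free_alg) graded_algebra)"
    by (rule abelian_groupI) (auto intro: exI [of _ "- _"] simp: add.assoc add.commute add.left_commute)
  show "Group.monoid (free_algebra :: ('k::field, ('g, 'k) free_alg) graded_algebra)"
    by (rule monoidI) (auto simp: mult.assoc)
qed (auto simp: algebra_simps)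

abbreviation rel_ideal :: "('g, 'k::field) free_alg set \<Rightarrow> ('g, 'k) free_alg set" where
  "rel_ideal rels \<equiv> Idl\<^bsub>free_algebra\<^esub> rels"

lemma rel_ideal_base: "p \<in> rels \<Longrightarrow> p \<in> rel_ideal rels"
  using ring.genideal_self [OF free_algebra_ring] by fastforce

lemma
  shows rel_ideal_mult_left: "x \<in> rel_ideal rels \<Longrightarrow> p * x \<in> rel_ideal rels"
    and rel_ideal_mult_right: "x \<in> rel_ideal rels \<Longrightarrow> x * p \<in> rel_ideal rels"
    and rel_ideal_subspace: "pscale.subspace (rel_ideal rels)"
proof -
  interpret I: ideal "rel_ideal rels" free_algebra
    by (rule ring.genideal_ideal [OF free_algebra_ring]) simp
  show *: "x \<in> rel_ideal rels \<Longrightarrow> p * x \<in> rel_ideal rels" for p x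
    using I.I_l_closed [of x p] by simp
  show "x \<in> rel_ideal rels \<Longrightarrow> x * p \<in> rel_ideal rels"
    using I.I_r_closed [of x p] by simp
  show "pscale.subspace (rel_ideal rels)"
    using * [of _ "scalar _"] additive_subgroup.zero_closed [OF I.additive_subgroup_axioms]
      additive_subgroup.a_closed [OF I.additive_subgroup_axioms]
    by (auto simp: pscale.subspace_def scalar_times)
qed

lemma rel_ideal_least:
  assumes "rels \<subseteq> J" "pscale.subspace J"
    and "\<And>p x. x \<in> J \<Longrightarrow> p * x \<in> J" "\<And>p x. x \<in> J \<Longrightarrow> x * p \<in> J"
  shows "rel_ideal rels \<subseteq> J"
proof (rule ring.genideal_minimal [OF free_algebra_ring])
  have inv: "\<ominus>\<^bsub>free_algebra\<^esub> x = - x" for x :: "('a, 'b) free_alg"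
    by (rule abelian_group.minus_equality [OF ring.is_abelian_group [OF free_algebra_ring]]) simp_all
  show "ideal J free_algebra"
  proof (rule idealI [OF free_algebra_ring])
    show "subgroup J (add_monoid free_algebra)"
      using assms(2) inv unfolding a_inv_def
      by (intro group.subgroupI abelian_group.a_group ring.is_abelian_group [OF free_algebra_ring])
        (auto intro: pscale.subspace_0 pscale.subspace_neg pscale.subspace_add)
  qed (use assms in auto)
qed (use assms in auto)

text \<open>
  The quotients of algebras and of spaces are built from the operations of a record. Whenever the
  addition of that record is the addition of a type, their elements are the following translates,
  and the operations on cosets are computed on arbitrary representatives.
\<close>
definition coset :: "'a set \<Rightarrow> 'a \<Rightarrow> 'a::ab_group_add set" where
  "coset N x = (\<lambda>n. n + x) ` N"

lemma coset_eq_iff: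
  assumes "pscale.subspace N"
  shows "coset N x = coset N y \<longleftrightarrow> x - y \<in> N"
proof
  assume "coset N x = coset N y"
  moreover have "0 + x \<in> coset N x"
    unfolding coset_def using pscale.subspace_0 [OF assms] by blast
  ultimately show "x - y \<in> N"
    by (auto simp: coset_def)
next
  assume xy: "x - y \<in> N"
  have "n + x \<in> coset N y" if "n \<in> N" for n
    using pscale.subspace_add [OF assms that xy] by (auto simp: coset_def image_iff intro!: bexI [of _ "n + (x - y)"])
  moreover have "n + y \<in> coset N x" if "n \<in> N" for n
    using pscale.subspace_diff [OF assms that xy] by (auto simp: coset_def image_iff intro!: bexI [of _ "n - (x - y)"])
  ultimately show "coset N x = coset N y"
    by (auto simp: coset_def)
qed

lemma coset_zero: "coset N 0 = N"
  by (simp add: coset_def)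

lemma a_r_coset_coset: "add G = (+) \<Longrightarrow> N +>\<^bsub>G\<^esub> x = coset N x"
  by (auto simp: a_r_coset_def r_coset_def coset_def)

lemma a_rcosets_coset: "add G = (+) \<Longrightarrow> a_rcosets\<^bsub>G\<^esub> N = coset N ` carrier G"
  by (auto simp: A_RCOSETS_def RCOSETS_def r_coset_def coset_def image_def)

lemma set_add_coset:
  assumes "add G = (+)" "pscale.subspace N"
  shows "coset N x <+>\<^bsub>G\<^esub> coset N y = coset N (x + y)"
proof -
  have "\<exists>n\<in>N. a + x + (b + y) = n + (x + y)" if "a \<in> N" "b \<in> N" for a b
    using that pscale.subspace_add [OF assms(2)] by (intro bexI [of _ "a + b"]) (simp_all add: ac_simps)
  moreover have "\<exists>a\<in>N. \<exists>b\<in>N. n + (x + y) = a + x + (b + y)" if "n \<in> N" for n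
    using that pscale.subspace_0 [OF assms(2)] by (intro bexI [of _ n] bexI [of _ 0]) (simp_all add: ac_simps)
  ultimately show ?thesis
    by (auto simp: set_add_def set_mult_def coset_def assms(1) image_iff)
qed

lemma coset_smult_coset:
  assumes "add G = (+)" "module.smult G = pscale" "pscale.subspace N"
  shows "coset_smult G N c (coset N x) = coset N (pscale c x)"
proof -
  have "\<exists>n\<in>N. a + pscale c (b + x) = n + pscale c x" if "a \<in> N" "b \<in> N" for a b
    using that pscale.subspace_add [OF assms(3)] pscale.subspace_scale [OF assms(3)]
    by (intro bexI [of _ "a + pscale c b"]) (simp_all add: pscale.scale_right_distrib ac_simps)
  moreover have "\<exists>a\<in>N. \<exists>b\<in>N. n + pscale c x = a + pscale c (b + x)" if "n \<in> N" for n
    using that pscale.subspace_0 [OF assms(3)] by (intro bexI [of _ n] bexI [of _ 0]) simp_all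
  ultimately show ?thesis
    by (auto simp: coset_smult_def set_add_def set_mult_def coset_def assms(1,2) image_iff)
qed

section \<open>Presented algebras\<close>

definition cls :: "('g, 'k::field) free_alg set \<Rightarrow> ('g, 'k) free_alg \<Rightarrow> ('g, 'k) free_alg set" where
  "cls rels p = coset (rel_ideal rels) p"

lemma cls_eq_iff: "cls rels p = cls rels q \<longleftrightarrow> p - q \<in> rel_ideal rels"
  by (simp add: cls_def coset_eq_iff rel_ideal_subspace)

lemma gen_class_cls: "gen_class rels g = cls rels (gen g)"
  by (simp add: gen_class_def cls_def a_r_coset_coset)

definition homogeneous :: "nat \<Rightarrow> ('g, 'k::field) free_alg \<Rightarrow> bool" where
  "homogeneous n p \<longleftrightarrow> (\<forall>w\<in>Poly_Mapping.keys p. length (letters w) = n)"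

lemma free_algebra_component [simp]: "component free_algebra n = {p. homogeneous n p}"
  by (simp add: free_algebra_def homogeneous_def)

lemma presented_algebra_mult:
  fixes rels :: "('g, 'k::field) free_alg set"
  shows "cls rels p \<otimes>\<^bsub>presented_algebra rels\<^esub> cls rels q = cls rels (p * q)"
proof -
  interpret I: ideal "rel_ideal rels" "free_algebra :: ('k, ('g, 'k) free_alg) graded_algebra"
    by (rule ring.genideal_ideal [OF free_algebra_ring]) simp
  show ?thesis
    using I.rcoset_mult_add [of p q]
    by (simp add: presented_algebra_def graded_quotient_def FactRing_def cls_def a_r_coset_coset)
qed

lemma presented_algebra_simps:
  "carrier (presented_algebra rels) = range (cls rels)"
  "one (presented_algebra rels) = cls rels 1"
  "zero (presented_algebra rels) = cls rels 0"
  "cls rels p \<oplus>\<^bsub>presented_algebra rels\<^esub> cls rels q = cls rels (p + q)"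
  "cls rels p \<otimes>\<^bsub>presented_algebra rels\<^esub> cls rels q = cls rels (p * q)"
  "c \<odot>\<^bsub>presented_algebra rels\<^esub> cls rels p = cls rels (pscale c p)"
  "component (presented_algebra rels) n = cls rels ` {p. homogeneous n p}"
  by (simp_all add: presented_algebra_mult)
    (auto simp: presented_algebra_def graded_quotient_def FactRing_def cls_def a_r_coset_coset
      a_rcosets_coset set_add_coset coset_smult_coset rel_ideal_subspace coset_zero)

definition homogeneous_part :: "nat \<Rightarrow> ('g, 'k::field) free_alg \<Rightarrow> ('g, 'k) free_alg" where
  "homogeneous_part n = lin_ext (\<lambda>w. if length (letters w) = n then Poly_Mapping.single w 1 else 0)"

lemma lin_homogeneous_part: "lin (homogeneous_part n)"
  by (simp add: homogeneous_part_def lin_lin_ext)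

lemma homogeneous_part_single: "homogeneous_part n (Poly_Mapping.single w c) = (if length (letters w) = n then Poly_Mapping.single w c else 0)"
  by (simp add: homogeneous_part_def)

lemma lookup_homogeneous_part: "Poly_Mapping.lookup (homogeneous_part n p) w = (if length (letters w) = n then Poly_Mapping.lookup p w else 0)"
  by (induction p rule: poly_mapping_linear_induct)
    (auto simp: lin_zero [OF lin_homogeneous_part] lin_add [OF lin_homogeneous_part] homogeneous_part_single lookup_add lookup_single when_def)

lemma homogeneous_homogeneous_part: "homogeneous n (homogeneous_part n p)"
  by (auto simp: homogeneous_def in_keys_iff lookup_homogeneous_part split: if_splits)

lemma homogeneous_part_homogeneous: "homogeneous n p \<Longrightarrow> homogeneous_part m p = (if m = n then p else 0)"
  by (rule poly_mapping_eqI) (auto simp: homogeneous_def in_keys_iff lookup_homogeneous_part)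

lemma homogeneous_zero: "homogeneous n 0"
  by (simp add: homogeneous_def)

lemma homogeneous_one: "homogeneous 0 1"
  by (auto simp: homogeneous_def)

lemma homogeneous_gen: "homogeneous 1 (gen g)"
  by (simp add: homogeneous_def gen_def)

lemma homogeneous_add: "homogeneous n p \<Longrightarrow> homogeneous n q \<Longrightarrow> homogeneous n (p + q)"
  using keys_add [of p q] by (auto simp: homogeneous_def)

lemma homogeneous_pscale: "homogeneous n p \<Longrightarrow> homogeneous n (pscale c p)"
  by (auto simp: homogeneous_def in_keys_iff)

lemma homogeneous_minus: "homogeneous n p \<Longrightarrow> homogeneous n (- p)"
  by (auto simp: homogeneous_def in_keys_iff)

lemma homogeneous_diff: "homogeneous n p \<Longrightarrow> homogeneous n q \<Longrightarrow> homogeneous n (p - q)"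
  using homogeneous_add [OF _ homogeneous_minus] by fastforce

lemma homogeneous_mult:
  assumes "homogeneous m p" "homogeneous n q"
  shows "homogeneous (m + n) (p * q)"
  using assms keys_mult [of p q] by (fastforce simp: homogeneous_def)

lemma homogeneous_mult_linear: "homogeneous 1 p \<Longrightarrow> homogeneous 1 q \<Longrightarrow> homogeneous 2 (p * q)"
  using homogeneous_mult [of 1 p 1 q] by (simp add: numeral_2_eq_2)

lemma homogeneous_power:
  assumes "homogeneous 1 x"
  shows "homogeneous n (x ^ n)"
proof (induction n)
  case 0
  then show ?case
    by (simp add: homogeneous_one)
next
  case (Suc n)
  then show ?case
    using homogeneous_mult [OF assms Suc] by simp
qed

lemma homogeneous_prod_list:
  "(\<And>x. x \<in> set xs \<Longrightarrow> homogeneous 1 x) \<Longrightarrow> homogeneous (length xs) (prod_list xs)"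
  by (induction xs) (auto simp: homogeneous_one intro: homogeneous_mult [of 1, simplified])

lemma homogeneous_lin_ext:
  assumes "homogeneous n p" "\<And>w. length (letters w) = n \<Longrightarrow> homogeneous m (F w)"
  shows "homogeneous m (lin_ext F p)"
proof -
  have "homogeneous m (\<Sum>w\<in>A. pscale (Poly_Mapping.lookup p w) (F w))"
    if "finite A" "A \<subseteq> Poly_Mapping.keys p" for A
    using that
    by induction (use assms in \<open>auto simp: homogeneous_zero homogeneous_def [of n]
      intro!: homogeneous_add homogeneous_pscale\<close>)
  then show ?thesis
    by (simp add: lin_ext_def)
qed

lemma homogeneous_subst:
  assumes "homogeneous n p" "\<And>g. homogeneous 1 (h g)"
  shows "homogeneous n (subst h p)"
  unfolding subst_def
  using assms(1) by (rule homogeneous_lin_ext) (use assms(2) homogeneous_prod_list [of "map h _"] in fastforce)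

lemma sum_homogeneous_parts: "finite A \<Longrightarrow> {n. homogeneous_part n p \<noteq> 0} \<subseteq> A \<Longrightarrow> (\<Sum>n\<in>A. homogeneous_part n p) = p"
proof (rule poly_mapping_eqI)
  fix w
  assume A: "finite A" "{n. homogeneous_part n p \<noteq> 0} \<subseteq> A"
  then have "length (letters w) \<notin> A \<Longrightarrow> Poly_Mapping.lookup p w = 0"
    by (metis (mono_tags, lifting) lookup_homogeneous_part lookup_zero mem_Collect_eq subsetD)
  then show "Poly_Mapping.lookup (\<Sum>n\<in>A. homogeneous_part n p) w = Poly_Mapping.lookup p w"
    using A(1) by (auto simp: lookup_sum lookup_homogeneous_part sum.delta')
qed

lemma finite_homogeneous_parts: "finite {n. homogeneous_part n p \<noteq> 0}"
proof -
  have "{n. homogeneous_part n p \<noteq> 0} \<subseteq> (\<lambda>w. length (letters w)) ` Poly_Mapping.keys p"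
  proof
    fix n assume "n \<in> {n. homogeneous_part n p \<noteq> 0}"
    then obtain w where "w \<in> Poly_Mapping.keys (homogeneous_part n p)"
      by (metis (mono_tags) keys_eq_empty mem_Collect_eq ex_in_conv)
    then show "n \<in> (\<lambda>w. length (letters w)) ` Poly_Mapping.keys p"
      by (auto simp: lookup_homogeneous_part in_keys_iff split: if_splits)
  qed
  then show ?thesis
    by (rule finite_subset) simp
qed

text \<open>
  An ideal generated by homogeneous elements is graded: the elements all of whose homogeneous parts
  lie in the ideal are themselves an ideal. For this it suffices to multiply by monomials, which
  only shift the degree.
\<close>
lemma homogeneous_part_rel_ideal:
  assumes "\<And>p. p \<in> rels \<Longrightarrow> \<exists>n. homogeneous n p" and "p \<in> rel_ideal rels"
  shows "homogeneous_part n p \<in> rel_ideal rels"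
proof -
  let ?J = "{p. \<forall>n. homogeneous_part n p \<in> rel_ideal rels}"
  have mono: "homogeneous_part n (Poly_Mapping.single w c * p) = (if n < length (letters w) then 0
      else Poly_Mapping.single w c * homogeneous_part (n - length (letters w)) p)"
    "homogeneous_part n (p * Poly_Mapping.single w c) = (if n < length (letters w) then 0
      else homogeneous_part (n - length (letters w)) p * Poly_Mapping.single w c)" for n w c and p :: "('a, 'b) free_alg"
    by (induction p rule: poly_mapping_linear_induct)
      (auto simp: lin_zero [OF lin_homogeneous_part] lin_add [OF lin_homogeneous_part] mult_single homogeneous_part_single distrib_left distrib_right)
  have "rel_ideal rels \<subseteq> ?J"
  proof (rule rel_ideal_least)
    show "rels \<subseteq> ?J"
    proof safe
      fix p m assume "p \<in> rels"
      moreover from this obtain n where "homogeneous n p"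
        using assms(1) by blast
      ultimately show "homogeneous_part m p \<in> rel_ideal rels"
        by (auto simp: homogeneous_part_homogeneous rel_ideal_base pscale.subspace_0 [OF rel_ideal_subspace])
    qed
    show sub: "pscale.subspace ?J"
      using rel_ideal_subspace [of rels]
      by (auto simp: pscale.subspace_def lin_zero [OF lin_homogeneous_part] lin_add [OF lin_homogeneous_part] lin_scale [OF lin_homogeneous_part])
    show "p * x \<in> ?J" if x: "x \<in> ?J" for p x
    proof (induction p rule: poly_mapping_linear_induct)
      case (single w c)
      then show ?case
        using x by (auto simp: mono rel_ideal_mult_left pscale.subspace_0 [OF rel_ideal_subspace])
    qed (use pscale.subspace_add [OF sub] pscale.subspace_0 [OF sub] in \<open>auto simp: distrib_right\<close>)
    show "x * p \<in> ?J" if x: "x \<in> ?J" for p x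
    proof (induction p rule: poly_mapping_linear_induct)
      case (single w c)
      then show ?case
        using x by (auto simp: mono rel_ideal_mult_right pscale.subspace_0 [OF rel_ideal_subspace])
    qed (use pscale.subspace_add [OF sub] pscale.subspace_0 [OF sub] in \<open>auto simp: distrib_left\<close>)
  qed
  then show ?thesis
    using assms(2) by blast
qed

lemma presented_algebra_ring: "ring (presented_algebra (rels :: ('g, 'k::field) free_alg set))"
proof (rule ringI)
  show "abelian_group (presented_algebra rels)"
  proof (rule abelian_groupI)
    fix x assume "x \<in> carrier (presented_algebra rels)"
    then obtain p where "x = cls rels p"
      by (auto simp: presented_algebra_simps)
    then show "\<exists>y\<in>carrier (presented_algebra rels). y \<oplus>\<^bsub>presented_algebra rels\<^esub> x = \<zero>\<^bsub>presented_algebra rels\<^esub>"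
      by (intro bexI [of _ "cls rels (- p)"]) (simp_all add: presented_algebra_simps)
  qed (auto simp: presented_algebra_simps ac_simps)
  show "Group.monoid (presented_algebra rels)"
    by (rule monoidI) (auto simp: presented_algebra_simps mult.assoc)
qed (auto simp: presented_algebra_simps distrib_left distrib_right)

lemma scalars_simps [simp]:
  "carrier (scalars :: 'k::field ring) = UNIV"
  "monoid.mult (scalars :: 'k::field ring) = (*)" "one (scalars :: 'k::field ring) = 1"
  "zero (scalars :: 'k::field ring) = 0" "add (scalars :: 'k::field ring) = (+)"
  by (simp_all add: ring_of_type_algebra_def)

lemma presented_algebra_module:
  "module (scalars :: 'k::field ring) (presented_algebra (rels :: ('g, 'k) free_alg set))"
proof (rule moduleI)
  show "cring (scalars :: 'k::field ring)"
    by (rule cring_from_type_algebra)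
  show "abelian_group (presented_algebra rels)"
    by (rule ring.is_abelian_group [OF presented_algebra_ring])
qed (auto simp: presented_algebra_simps pscale.scale_left_distrib pscale.scale_right_distrib)

lemma presented_algebra_finsum:
  "finite D \<Longrightarrow> finsum (presented_algebra rels) (\<lambda>n. cls rels (q n)) D = cls rels (\<Sum>n\<in>D. q n)"
proof (induction D rule: finite_induct)
  interpret abelian_group "presented_algebra rels"
    by (rule ring.is_abelian_group [OF presented_algebra_ring])
  {
    case empty
    then show ?case
      by (simp add: presented_algebra_simps)
  next
    case (insert n D)
    then show ?case
      by (subst finsum_insert) (auto simp: presented_algebra_simps)
  }
qed

text \<open>
  The homogeneous parts of a representative give the decomposition of a class, and it is unique
  because taking homogeneous parts preserves the ideal.
\<close>
lemma presented_algebra_graded: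
  fixes rels :: "('g, 'k::field) free_alg set"
  assumes hom: "\<And>p. p \<in> rels \<Longrightarrow> \<exists>n. homogeneous n p"
  shows "graded_algebra (presented_algebra rels)"
proof -
  let ?A = "presented_algebra rels"
  interpret ring ?A
    by (rule presented_algebra_ring)
  interpret module "scalars :: 'k ring" ?A
    by (rule presented_algebra_module)
  have inv: "\<ominus>\<^bsub>?A\<^esub> cls rels p = cls rels (- p)" for p
    by (rule abelian_group.minus_equality [OF ring.is_abelian_group [OF presented_algebra_ring]]) (auto simp: presented_algebra_simps)
  show ?thesis
  proof (intro graded_algebra.intro graded_algebra_axioms.intro presented_algebra_ring presented_algebra_module)
    fix n
    show "submodule (component ?A n) scalars ?A"
      by (rule submoduleI) (auto simp: presented_algebra_simps inv
          intro!: imageI homogeneous_zero homogeneous_minus homogeneous_add homogeneous_pscale)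
  next
    fix x assume "x \<in> carrier ?A"
    then obtain p where x: "x = cls rels p"
      by (auto simp: presented_algebra_simps)
    have zero_iff: "cls rels q \<noteq> \<zero>\<^bsub>?A\<^esub> \<Longrightarrow> q \<noteq> 0" for q
      by (auto simp: presented_algebra_simps)
    let ?comp = "\<lambda>f. (\<forall>n. f n \<in> component ?A n) \<and> finite {n. f n \<noteq> \<zero>\<^bsub>?A\<^esub>} \<and>
        x = (\<Oplus>\<^bsub>?A\<^esub>n\<in>{n. f n \<noteq> \<zero>\<^bsub>?A\<^esub>}. f n)"
    show "\<exists>!f. ?comp f"
    proof (rule ex1I)
      have fin: "finite {n. cls rels (homogeneous_part n p) \<noteq> \<zero>\<^bsub>?A\<^esub>}"
        by (rule finite_subset [OF _ finite_homogeneous_parts [of p]]) (auto simp: presented_algebra_simps)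
      let ?D = "{n. homogeneous_part n p \<noteq> 0}" and ?D' = "{n. cls rels (homogeneous_part n p) \<noteq> \<zero>\<^bsub>?A\<^esub>}"
      have "?D' \<subseteq> ?D"
        by (auto simp: presented_algebra_simps)
      then have "p - (\<Sum>n\<in>?D'. homogeneous_part n p) = (\<Sum>n\<in>?D - ?D'. homogeneous_part n p)"
        using sum_homogeneous_parts [OF finite_homogeneous_parts order_refl, of p] by (simp add: sum_diff finite_homogeneous_parts)
      also have "\<dots> \<in> rel_ideal rels"
        by (rule pscale.subspace_sum [OF rel_ideal_subspace])
          (auto simp: presented_algebra_simps cls_eq_iff)
      finally have "cls rels p = cls rels (\<Sum>n\<in>?D'. homogeneous_part n p)"
        by (simp add: cls_eq_iff)
      then show "?comp (\<lambda>n. cls rels (homogeneous_part n p))"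
        using fin by (auto simp: x presented_algebra_simps(7) homogeneous_homogeneous_part presented_algebra_finsum)
    next
      fix f assume f: "?comp f"
      then have "\<forall>n. \<exists>q. homogeneous n q \<and> f n = cls rels q"
        by (auto simp: presented_algebra_simps)
      then obtain q where q: "\<And>n. homogeneous n (q n)" "\<And>n. f n = cls rels (q n)"
        by metis
      define D where "D = {n. f n \<noteq> \<zero>\<^bsub>?A\<^esub>}"
      have D: "finite D" "x = cls rels (\<Sum>n\<in>D. q n)"
        using f by (simp_all add: D_def q(2) presented_algebra_finsum)
      show "f = (\<lambda>n. cls rels (homogeneous_part n p))"
      proof
        fix n
        have "homogeneous_part n (p - (\<Sum>n\<in>D. q n)) \<in> rel_ideal rels"
          using D(2) by (intro homogeneous_part_rel_ideal hom) (simp_all add: x cls_eq_iff)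
        moreover have "homogeneous_part n (\<Sum>n\<in>D. q n) = (if n \<in> D then q n else 0)"
          using D(1) by (simp add: lin_sum [OF lin_homogeneous_part] homogeneous_part_homogeneous [OF q(1)])
        ultimately have "cls rels (homogeneous_part n p) = cls rels (if n \<in> D then q n else 0)"
          by (simp add: cls_eq_iff lin_diff [OF lin_homogeneous_part])
        also have "\<dots> = f n"
          by (auto simp: q(2) D_def presented_algebra_simps)
        finally show "f n = cls rels (homogeneous_part n p)" ..
      qed
    qed
  qed (auto simp: presented_algebra_simps homogeneous_one homogeneous_mult pscale_mult_left
      simp flip: pscale_mult_right)
qed

text \<open>
  The class of \<open>p\<close> is sent to the class of \<open>subst h p\<close>. The value is independent of the chosen
  representative when \<open>h\<close> maps the relations of the source into the ideal of the target.
\<close>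
definition presented_hom ::
    "('h, 'k::field) free_alg set \<Rightarrow> ('g \<Rightarrow> ('h, 'k) free_alg) \<Rightarrow> ('g, 'k) free_alg set \<Rightarrow> ('h, 'k) free_alg set" where
  "presented_hom rels h V = cls rels (subst h (SOME p. p \<in> V))"

lemma presented_hom_cls:
  assumes "\<And>p. p \<in> rels \<Longrightarrow> subst h p \<in> rel_ideal rels'"
  shows "presented_hom rels' h (cls rels p) = cls rels' (subst h p)"
proof -
  have "rel_ideal rels \<subseteq> {p. subst h p \<in> rel_ideal rels'}"
    using assms rel_ideal_subspace [of rels']
    by (intro rel_ideal_least)
      (auto simp: pscale.subspace_def lin_zero [OF lin_subst] subst_add subst_pscale subst_mult
        rel_ideal_mult_left rel_ideal_mult_right)
  moreover have "(SOME q. q \<in> cls rels p) - p \<in> rel_ideal rels"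
  proof -
    have "0 + p \<in> cls rels p"
      unfolding cls_def coset_def using pscale.subspace_0 [OF rel_ideal_subspace] by blast
    then have "(SOME q. q \<in> cls rels p) \<in> cls rels p"
      by (rule someI)
    then show ?thesis
      by (auto simp: cls_def coset_def)
  qed
  ultimately show ?thesis
    by (auto simp: presented_hom_def cls_eq_iff simp flip: subst_diff)
qed

lemma presented_hom_graded_algebra_hom:
  assumes rels: "\<And>p. p \<in> rels \<Longrightarrow> subst h p \<in> rel_ideal rels'"
    and "\<And>g. homogeneous 1 (h g)"
  shows "presented_hom rels' h \<in> graded_algebra_hom (presented_algebra rels) (presented_algebra rels')"
  using assms(2) unfolding graded_algebra_hom_def
  by (auto intro!: ring_hom_memI homogeneous_subst
      simp: presented_algebra_simps presented_hom_cls [OF rels] subst_mult subst_add subst_pscale)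

lemma graded_isomorphic_presented_algebra:
  assumes "\<And>p. p \<in> rels \<Longrightarrow> subst h p \<in> rel_ideal rels'" "\<And>p. p \<in> rels' \<Longrightarrow> subst h' p \<in> rel_ideal rels"
    and "\<And>g. homogeneous 1 (h g)"
    and "\<And>g. subst h' (h g) = gen g" "\<And>g. subst h (h' g) = gen g"
  shows "graded_isomorphic (presented_algebra rels) (presented_algebra rels')"
  unfolding graded_isomorphic_def
proof (intro bexI bij_betw_byWitness [where f' = "presented_hom rels h'"])
  show "presented_hom rels' h \<in> graded_algebra_hom (presented_algebra rels) (presented_algebra rels')"
    by (rule presented_hom_graded_algebra_hom [OF assms(1,3)])
qed (auto simp: presented_algebra_simps presented_hom_cls [OF assms(1)] presented_hom_cls [OF assms(2)]
    subst_subst assms(4,5))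

section \<open>Normal forms modulo an ideal\<close>

lemmas rel_ideal_closed = pscale.subspace_add [OF rel_ideal_subspace] pscale.subspace_diff [OF rel_ideal_subspace]
   pscale.subspace_scale [OF rel_ideal_subspace]
  rel_ideal_mult_left rel_ideal_mult_right

lemmas pscale_algebra = power2_eq_square mult.assoc distrib_left distrib_right left_diff_distrib right_diff_distrib
   pscale.scale_right_distrib pscale.scale_right_diff_distrib pscale.scale_left_distrib pscale.scale_left_diff_distrib
   pscale_mult_left [symmetric] pscale_mult_right [symmetric]

lemma pscale_two: "pscale 2 x = x + (x :: 'b \<Rightarrow>\<^sub>0 'k::field)"
  by (rule poly_mapping_eqI) (simp add: lookup_add)

lemma power_mult_commute: "x ^ n * (x * y) = x * (x ^ n * (y :: 'a::monoid_mult))"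
  by (metis mult.assoc power_commutes)

lemma swap_power:
  assumes "x * y - pscale c (y * x) \<in> rel_ideal rels"
  shows "x * y ^ n - pscale (c ^ n) (y ^ n * x) \<in> rel_ideal rels"
proof (induction n)
  case (Suc n)
  have "x * y ^ Suc n - pscale (c ^ Suc n) (y ^ Suc n * x) =
      (x * y ^ n - pscale (c ^ n) (y ^ n * x)) * y + pscale (c ^ n) (y ^ n * (x * y - pscale c (y * x)))"
    by (simp add: pscale_algebra power_Suc2 del: power_Suc)
  also have "\<dots> \<in> rel_ideal rels"
    by (intro rel_ideal_closed Suc assms)
  finally show ?case .
qed (simp add: pscale.subspace_0 [OF rel_ideal_subspace])

text \<open>
  If left multiplication by each generator can be rewritten modulo the ideal on the candidate basis
  elements \<open>B b\<close>, then these span the quotient: by induction on words, \<open>p * B b\<close> is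
  congruent to the combination that the action of \<open>p\<close> prescribes, and the case \<open>B b0 = 1\<close>
  yields a normal form of \<open>p\<close>. No termination order is involved.
\<close>
lemma normal_form_exists:
  fixes B :: "'b \<Rightarrow> ('g, 'k::field) free_alg"
  assumes T: "\<And>g. lin (T g)" and "B b0 = 1"
    and straighten: "\<And>g b. gen g * B b - lin_ext B (T g (Poly_Mapping.single b 1)) \<in> rel_ideal rels"
  shows "p - lin_ext B (act T p (Poly_Mapping.single b0 1)) \<in> rel_ideal rels"
proof -
  note I = pscale.subspace_0 [OF rel_ideal_subspace] pscale.subspace_add [OF rel_ideal_subspace]
    pscale.subspace_scale [OF rel_ideal_subspace]
  have gen: "gen g * lin_ext B v - lin_ext B (T g v) \<in> rel_ideal rels" for g v
  proof (induction v rule: poly_mapping_linear_induct)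
    case (single b c)
    have "lin_ext B (T g (Poly_Mapping.single b c)) = pscale c (lin_ext B (T g (Poly_Mapping.single b 1)))"
      by (subst single_eq_pscale) (simp only: lin_scale [OF T] lin_scale [OF lin_lin_ext])
    then show ?case
      using I(3) [OF straighten, of c g b]
      by (simp add: pscale.scale_right_diff_distrib pscale_mult_right)
  next
    case (add v w)
    show ?case
      using I(2) [OF add] by (simp add: lin_add [OF T] lin_add [OF lin_lin_ext] algebra_simps)
  qed (simp add: lin_zero [OF T] lin_zero [OF lin_lin_ext] I)
  have word: "prod_list (map gen ws) * lin_ext B v - lin_ext B (act T (prod_list (map gen ws)) v) \<in> rel_ideal rels"
    for ws v
  proof (induction ws)
    case (Cons g ws)
    let ?p = "prod_list (map gen ws)"
    have "gen g * (?p * lin_ext B v - lin_ext B (act T ?p v))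
        + (gen g * lin_ext B (act T ?p v) - lin_ext B (T g (act T ?p v))) \<in> rel_ideal rels"
      by (intro I rel_ideal_mult_left Cons gen)
    then show ?case
      by (simp add: act_mult [OF T] algebra_simps)
  qed (simp add: I)
  have "p * lin_ext B v - lin_ext B (act T p v) \<in> rel_ideal rels" for v
  proof (induction p rule: poly_mapping_linear_induct)
    case (single w c)
    show ?case
      using I(3) [OF word, of c "letters w" v]
      by (subst (1 2) single_eq_pscale)
        (simp only: single_Word lin_scale [OF lin_act_left] lin_scale [OF lin_lin_ext]
          pscale.scale_right_diff_distrib pscale_mult_left)
  next
    case (add p q)
    show ?case
      using I(2) [OF add] by (simp add: act_add lin_add [OF lin_lin_ext] algebra_simps)
  qed (simp add: lin_zero [OF lin_lin_ext] lin_zero [OF lin_act_left] I)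
  from this [of "Poly_Mapping.single b0 1"] show ?thesis
    by (simp add: \<open>B b0 = 1\<close>)
qed

text \<open>
  This is the tool for linear independence: an action that annihilates the relations factors through
  the quotient, so its values separate classes.
\<close>
lemma act_rel_ideal:
  assumes T: "\<And>g. lin (T g)" and rels: "\<And>p b. p \<in> rels \<Longrightarrow> act T p (Poly_Mapping.single b 1) = 0"
    and "p \<in> rel_ideal rels"
  shows "act T p v = 0"
proof -
  have "act T p v = 0" if "p \<in> rels" for p v
    by (rule lin_eqI [of "act T p" "\<lambda>_. 0"]) (use rels [OF that] in \<open>simp_all add: lin_act_right [OF T] linI\<close>)
  then have "rel_ideal rels \<subseteq> {p. \<forall>v. act T p v = 0}"
    by (intro rel_ideal_least)
      (auto simp: pscale.subspace_def lin_zero [OF lin_act_left] lin_zero [OF lin_act_right [OF T]]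
         act_add lin_scale [OF lin_act_left] act_mult [OF T])
  then show ?thesis
    using assms(3) by blast
qed

lemma presented_algebra_generated:
  assumes "\<And>p. \<exists>v. p - lin_ext B v \<in> rel_ideal rels"
  shows "carrier (presented_algebra rels) \<subseteq> generated_submodule (presented_algebra rels) (range (\<lambda>b. cls rels (B b)))"
proof
  fix x assume "x \<in> carrier (presented_algebra rels)"
  then obtain p where x: "x = cls rels p"
    by (auto simp: presented_algebra_simps)
  obtain v where v: "p - lin_ext B v \<in> rel_ideal rels"
    using assms by blast
  show "x \<in> generated_submodule (presented_algebra rels) (range (\<lambda>b. cls rels (B b)))"
    unfolding generated_submodule_def
  proof safe
    fix N assume N: "submodule N scalars (presented_algebra rels)" and B: "range (\<lambda>b. cls rels (B b)) \<subseteq> N"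
    note N' = module.submoduleE [OF presented_algebra_module N]
    have smult: "cls rels (pscale c q) \<in> N" if "cls rels q \<in> N" for c q
      using N'(4) [of c "cls rels q"] that by (simp add: presented_algebra_simps)
    have "cls rels (lin_ext B v) \<in> N"
    proof (induction v rule: poly_mapping_linear_induct)
      case zero
      obtain b where "cls rels (B b) \<in> N"
        using B by blast
      from smult [OF this, of 0] show ?case
        by (simp add: lin_zero [OF lin_lin_ext])
    next
      case (single b c)
      then show ?case
        using B by (auto intro: smult)
    next
      case (add p q)
      then show ?case
        using N'(5) [of "cls rels (lin_ext B p)" "cls rels (lin_ext B q)"]
        by (simp add: lin_add [OF lin_lin_ext] presented_algebra_simps)
    qed
    then show "x \<in> N"
      using v by (simp add: x cls_eq_iff [THEN iffD2])
  qed
qed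

section \<open>The monomial basis of \<open>P(a)\<close>\<close>

text \<open>
  The exponents of \<open>r\<close> and \<open>s\<close> are paired, so that the index set is the product of those of
  the bases \<open>r\<^sup>i s\<^sup>j\<close> and \<open>t\<^sup>k\<close> of the two factors.
\<close>
fun P_basis :: "(nat \<times> nat) \<times> nat \<Rightarrow> (rst, 'k::field) free_alg" where
  "P_basis ((i, j), k) = gen Gen_r ^ i * gen Gen_s ^ j * gen Gen_t ^ k"

text \<open>
  Left multiplication by a generator, expanded in the monomials. In the case of \<open>t\<close>, moving \<open>t\<close>
  past \<open>r\<^sup>i s\<^sup>j\<close> changes the sign \<open>i + j\<close> times. Since squares are central, only a
  remaining odd factor \<open>r\<close> or \<open>s\<close> contributes further terms: it is replaced by
  \<open>t r + r t = t\<^sup>2 + a r\<^sup>2\<close> or by \<open>t s + s t = t\<^sup>2 + a r\<^sup>2 + 2 s\<^sup>2\<close>.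
\<close>
fun P_basis_op :: "'k::field \<Rightarrow> rst \<Rightarrow> (nat \<times> nat) \<times> nat \<Rightarrow> ((nat \<times> nat) \<times> nat \<Rightarrow>\<^sub>0 'k)" where
  "P_basis_op a Gen_r ((i, j), k) = Poly_Mapping.single ((i + 1, j), k) 1"
| "P_basis_op a Gen_s ((i, j), k) = Poly_Mapping.single ((i, j + 1), k) ((- 1) ^ i)"
| "P_basis_op a Gen_t ((i, j), k) =
    Poly_Mapping.single ((i, j), k + 1) ((- 1) ^ (i + j)) +
    (if odd i then Poly_Mapping.single ((i - 1, j), k + 2) 1 + Poly_Mapping.single ((i + 1, j), k) a else 0) +
    (if odd j then pscale ((- 1) ^ i) (Poly_Mapping.single ((i, j - 1), k + 2) 1 +
        Poly_Mapping.single ((i + 2, j - 1), k) a + Poly_Mapping.single ((i, j + 1), k) 2) else 0)"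

definition P_op :: "'k::field \<Rightarrow> rst \<Rightarrow> ((nat \<times> nat) \<times> nat \<Rightarrow>\<^sub>0 'k) \<Rightarrow> ((nat \<times> nat) \<times> nat \<Rightarrow>\<^sub>0 'k)" where
  "P_op a g = lin_ext (P_basis_op a g)"

lemma lin_P_op: "lin (P_op a g)"
  by (simp add: P_op_def lin_lin_ext)

text \<open>
  Written in this way, coefficients of basis vectors are atoms to the simplifier, and an identity
  between linear combinations becomes one in the coefficient field.
\<close>
lemma lookup_single_of_bool: "Poly_Mapping.lookup (Poly_Mapping.single x c) y = c * of_bool (x = y)"
  for c :: "'k::field"
  by (simp add: lookup_single when_def)

lemma P_op_relations:
  assumes "p \<in> P_relations a"
  shows "act (P_op a) p (Poly_Mapping.single b 1) = 0"
proof -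
  obtain i j k where b: "b = ((i, j), k)"
    by (metis surj_pair)
  note simps = lin_add [OF lin_act_left] lin_diff [OF lin_act_left] act_mult [OF lin_P_op]
    scalar_times lin_scale [OF lin_act_left] power2_eq_square distrib_left distrib_right left_diff_distrib right_diff_distrib
    P_op_def lin_add [OF lin_lin_ext] lin_diff [OF lin_lin_ext] lin_minus [OF lin_lin_ext] lin_scale [OF lin_lin_ext]
  consider "p = gen Gen_r * gen Gen_s + gen Gen_s * gen Gen_r"
    | "p = gen Gen_t * gen Gen_r + gen Gen_r * gen Gen_t - gen Gen_t ^ 2 - scalar a * gen Gen_r ^ 2"
    | "p = gen Gen_t * (gen Gen_r - gen Gen_s) + (gen Gen_r - gen Gen_s) * gen Gen_t + scalar 2 * gen Gen_s ^ 2"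
    using assms by (auto simp: P_relations_def Let_def)
  then show ?thesis
  proof cases
    case 1
    show ?thesis
      by (simp add: 1 b simps, intro poly_mapping_eqI, simp add: lookup_add lookup_single_of_bool)
  next
    case 2
    show ?thesis
      unfolding 2 b
      by (cases "even i"; cases "even j"; auto elim!: evenE oddE simp add: simps;
          intro poly_mapping_eqI; simp add: lookup_add lookup_minus lookup_single_of_bool algebra_simps)
  next
    case 3
    show ?thesis
      unfolding 3 b
      by (cases "even i"; cases "even j"; auto elim!: evenE oddE simp add: simps;
          intro poly_mapping_eqI; simp add: lookup_add lookup_minus lookup_single_of_bool algebra_simps)
  qed
qed

lemma P_op_power:
  "act (P_op a) (gen Gen_r ^ n) (Poly_Mapping.single ((i, j), k) 1) = Poly_Mapping.single ((n + i, j), k) 1"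
  "act (P_op a) (gen Gen_s ^ n) (Poly_Mapping.single ((0, j), k) 1) = Poly_Mapping.single ((0, n + j), k) 1"
  "act (P_op a) (gen Gen_t ^ n) (Poly_Mapping.single ((0, 0), k) 1) = Poly_Mapping.single ((0, 0), n + k) 1"
  by (induction n) (simp_all add: act_mult [OF lin_P_op], simp_all add: P_op_def)

lemma act_P_basis: "act (P_op a) (P_basis b) (Poly_Mapping.single ((0, 0), 0) 1) = Poly_Mapping.single b 1"
  by (cases b rule: P_basis.cases) (simp add: act_mult [OF lin_P_op] P_op_power)

text \<open>
  Modulo the second relation, the third one becomes
  \<open>t s + s t = t\<^sup>2 + a r\<^sup>2 + 2 s\<^sup>2\<close>. Then every relation expresses an anticommutator of
  two generators through squares.
\<close>
lemma P_relations_ideal: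
  fixes a :: "'k::field"
  defines "r \<equiv> gen Gen_r :: (rst, 'k) free_alg" and "s \<equiv> gen Gen_s" and "t \<equiv> gen Gen_t"
  assumes p: "p = r * s + s * r \<or> p = t * r + r * t - t ^ 2 - pscale a (r ^ 2) \<or>
      p = t * s + s * t - t ^ 2 - pscale a (r ^ 2) - pscale 2 (s ^ 2)"
  shows "p \<in> rel_ideal (P_relations a)"
proof -
  let ?I = "rel_ideal (P_relations a)"
  note sub = rel_ideal_subspace [of "P_relations a"]
  have 1: "r * s + s * r \<in> ?I" and 2: "t * r + r * t - t ^ 2 - pscale a (r ^ 2) \<in> ?I"
    and 3: "t * (r - s) + (r - s) * t + pscale 2 (s ^ 2) \<in> ?I"
    by (rule rel_ideal_base, simp add: P_relations_def r_def s_def t_def Let_def scalar_times)+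
  have 4: "t * s + s * t - t ^ 2 - pscale a (r ^ 2) - pscale 2 (s ^ 2) =
      (t * r + r * t - t ^ 2 - pscale a (r ^ 2)) - (t * (r - s) + (r - s) * t + pscale 2 (s ^ 2))"
    by (simp add: algebra_simps)
  show ?thesis
    using p 1 2 pscale.subspace_diff [OF sub 2 3] unfolding 4 by blast
qed

context
  fixes a :: "'k::field" and r s t :: "(rst, 'k) free_alg"
  defines "r \<equiv> gen Gen_r" and "s \<equiv> gen Gen_s" and "t \<equiv> gen Gen_t"
  assumes a: "a \<noteq> 1"
begin

lemma rel_rs: "r * s + s * r \<in> rel_ideal (P_relations a)"
  and rel_rt: "t * r + r * t - t ^ 2 - pscale a (r ^ 2) \<in> rel_ideal (P_relations a)"
  and rel_st: "t * s + s * t - t ^ 2 - pscale a (r ^ 2) - pscale 2 (s ^ 2) \<in> rel_ideal (P_relations a)"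
  using P_relations_ideal [of _ a] by (simp_all add: r_def s_def t_def)

lemma rr_s: "r ^ 2 * s - s * r ^ 2 \<in> rel_ideal (P_relations a)"
proof -
  have "r ^ 2 * s - s * r ^ 2 = r * (r * s + s * r) - (r * s + s * r) * r"
    by (simp add: pscale_algebra)
  also have "\<dots> \<in> rel_ideal (P_relations a)"
    by (intro rel_ideal_closed rel_rs)
  finally show ?thesis .
qed

text \<open>
  Write \<open>q\<close> for the relation between \<open>r\<close> and \<open>t\<close>. As \<open>t r + r t\<close> is congruent to
  \<open>t\<^sup>2 + a r\<^sup>2\<close>, the commutator of \<open>r\<^sup>2\<close> with \<open>t\<close>, which equals that of
  \<open>r\<close> with \<open>t r + r t\<close>, is congruent to \<open>a\<close> times itself. The multiple
  \<open>1 - a\<close> of it is exactly the commutator of \<open>r - t\<close> with \<open>q\<close>.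
\<close>
lemma rr_t: "r ^ 2 * t - t * r ^ 2 \<in> rel_ideal (P_relations a)"
proof -
  let ?q = "t * r + r * t - t ^ 2 - pscale a (r ^ 2)"
  have "r ^ 2 * t - t * r ^ 2 = pscale (1 / (1 - a)) ((r - t) * ?q - ?q * (r - t))"
  proof -
    have "pscale (1 - a) (r ^ 2 * t - t * r ^ 2) = (r - t) * ?q - ?q * (r - t)"
      by (simp add: pscale_algebra)
    from this [symmetric] show ?thesis
      using a by simp
  qed
  also have "\<dots> \<in> rel_ideal (P_relations a)"
    by (intro rel_ideal_closed rel_rt)
  finally show ?thesis .
qed

lemma tt_r: "t ^ 2 * r - r * t ^ 2 \<in> rel_ideal (P_relations a)"
proof -
  let ?q = "t * r + r * t - t ^ 2 - pscale a (r ^ 2)"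
  have "t ^ 2 * r - r * t ^ 2 = (t * ?q - ?q * t) - pscale a (r ^ 2 * t - t * r ^ 2)"
    by (simp add: pscale_algebra)
  also have "\<dots> \<in> rel_ideal (P_relations a)"
    by (intro rel_ideal_closed rel_rt rr_t)
  finally show ?thesis .
qed

text \<open>
  The same argument for \<open>s\<close> and \<open>t\<close> gives twice the commutator of \<open>s\<^sup>2\<close> and
  \<open>t\<close> in place of \<open>a\<close> times, so the factor to be cancelled is \<open>1 - 2 = - 1\<close>.
\<close>
lemma tt_s: "t ^ 2 * s - s * t ^ 2 \<in> rel_ideal (P_relations a)"
proof -
  let ?q = "t * s + s * t - t ^ 2 - pscale a (r ^ 2) - pscale 2 (s ^ 2)"
  let ?c = "?q * (s - t) - (s - t) * ?q - pscale a (s * r ^ 2 - r ^ 2 * s) + pscale a (t * r ^ 2 - r ^ 2 * t)"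
  have "s ^ 2 * t - t * s ^ 2 = ?c"
    by (simp add: pscale_algebra pscale_two)
  also have "?c = ?q * (s - t) - (s - t) * ?q + pscale a (r ^ 2 * s - s * r ^ 2) - pscale a (r ^ 2 * t - t * r ^ 2)"
    by (simp add: pscale_algebra)
  also have "\<dots> \<in> rel_ideal (P_relations a)"
    by (intro rel_ideal_closed rel_st rr_s rr_t)
  finally have *: "s ^ 2 * t - t * s ^ 2 \<in> rel_ideal (P_relations a)" .
  have "t ^ 2 * s - s * t ^ 2 = (t * ?q - ?q * t) - pscale a (r ^ 2 * t - t * r ^ 2) - pscale 2 (s ^ 2 * t - t * s ^ 2)"
    by (simp add: pscale_algebra)
  also have "\<dots> \<in> rel_ideal (P_relations a)"
    by (intro rel_ideal_closed rel_st rr_t *)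
  finally show ?thesis .
qed

text \<open>
  When \<open>n\<close> increases to an even number, the correction terms of the two steps cancel, because
  \<open>t\<^sup>2\<close> commutes with \<open>r\<close>.
\<close>
lemma t_r_power:
  "t * r ^ n - pscale ((- 1) ^ n) (r ^ n * t) - (if odd n then r ^ (n - 1) * t ^ 2 + pscale a (r ^ (n + 1)) else 0) \<in> rel_ideal (P_relations a)"
proof (induction n)
  case (Suc n)
  let ?q = "t * r + r * t - t ^ 2 - pscale a (r ^ 2)"
  show ?case
  proof (cases "even n")
    case True
    then have IH: "t * r ^ n - r ^ n * t \<in> rel_ideal (P_relations a)"
      using Suc by simp
    from True have "t * r ^ Suc n - pscale ((- 1) ^ Suc n) (r ^ Suc n * t) - (r ^ n * t ^ 2 + pscale a (r ^ (Suc n + 1)))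
       = (t * r ^ n - r ^ n * t) * r + r ^ n * ?q"
      by (simp add: pscale_algebra power_commutes power_mult_commute)
    also have "\<dots> \<in> rel_ideal (P_relations a)"
      by (intro rel_ideal_closed rel_rt IH)
    finally show ?thesis
      using True by simp
  next
    case False
    then obtain m where n: "n = Suc m" "even m"
      by (cases n) auto
    have IH: "t * r ^ n + r ^ n * t - (r ^ m * t ^ 2 + pscale a (r ^ (n + 1))) \<in> rel_ideal (P_relations a)"
      using Suc n by simp
    from n have "t * r ^ Suc n - pscale ((- 1) ^ Suc n) (r ^ Suc n * t)
       = (t * r ^ n + r ^ n * t - (r ^ m * t ^ 2 + pscale a (r ^ (n + 1)))) * r - r ^ n * ?q + r ^ m * (t ^ 2 * r - r * t ^ 2)"
      by (simp add: pscale_algebra power_commutes power_mult_commute)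
    also have "\<dots> \<in> rel_ideal (P_relations a)"
      by (intro rel_ideal_closed rel_rt tt_r IH)
    finally show ?thesis
      using False by simp
  qed
qed (simp add: pscale.subspace_0 [OF rel_ideal_subspace])

text \<open>
  Besides \<open>t\<^sup>2\<close>, also \<open>r\<^sup>2\<close> has to be moved past powers of \<open>s\<close>, since the
  monomials have \<open>r\<close> on the left.
\<close>
lemma t_s_power:
  "t * s ^ n - pscale ((- 1) ^ n) (s ^ n * t) - (if odd n then s ^ (n - 1) * t ^ 2 + pscale a (r ^ 2 * s ^ (n - 1)) + pscale 2 (s ^ (n + 1)) else 0) \<in> rel_ideal (P_relations a)"
proof (induction n)
  case (Suc n)
  let ?q = "t * s + s * t - t ^ 2 - pscale a (r ^ 2) - pscale 2 (s ^ 2)"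
  have c: "r ^ 2 * s ^ n - s ^ n * r ^ 2 \<in> rel_ideal (P_relations a)"
    using swap_power [of "r ^ 2" s 1 _ n] rr_s by simp
  show ?case
  proof (cases "even n")
    case True
    then have IH: "t * s ^ n - s ^ n * t \<in> rel_ideal (P_relations a)"
      using Suc by simp
    from True have "t * s ^ Suc n - pscale ((- 1) ^ Suc n) (s ^ Suc n * t) - (s ^ n * t ^ 2 + pscale a (r ^ 2 * s ^ n) + pscale 2 (s ^ (Suc n + 1)))
       = (t * s ^ n - s ^ n * t) * s + s ^ n * ?q - pscale a (r ^ 2 * s ^ n - s ^ n * r ^ 2)"
      by (simp add: pscale_algebra power_commutes power_mult_commute)
    also have "\<dots> \<in> rel_ideal (P_relations a)"
      by (intro rel_ideal_closed rel_st c IH)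
    finally show ?thesis
      using True by simp
  next
    case False
    then obtain m where n: "n = Suc m" "even m"
      by (cases n) auto
    have IH: "t * s ^ n + s ^ n * t - (s ^ m * t ^ 2 + pscale a (r ^ 2 * s ^ m) + pscale 2 (s ^ (n + 1))) \<in> rel_ideal (P_relations a)"
      using Suc n by simp
    from n have "t * s ^ Suc n - pscale ((- 1) ^ Suc n) (s ^ Suc n * t)
       = (t * s ^ n + s ^ n * t - (s ^ m * t ^ 2 + pscale a (r ^ 2 * s ^ m) + pscale 2 (s ^ (n + 1)))) * s - s ^ n * ?q + s ^ m * (t ^ 2 * s - s * t ^ 2)
        + pscale a (r ^ 2 * s ^ n - s ^ n * r ^ 2)"
      by (simp add: pscale_algebra power_commutes power_mult_commute)
    also have "\<dots> \<in> rel_ideal (P_relations a)"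
      by (intro rel_ideal_closed rel_st tt_s c IH)
    finally show ?thesis
      using False by simp
  qed
qed (simp add: pscale.subspace_0 [OF rel_ideal_subspace])

text \<open>
  The actual multiplication agrees modulo the ideal with the operators \<open>P_op a g\<close>.
\<close>
lemma P_straighten: "gen g * P_basis b - lin_ext P_basis (P_op a g (Poly_Mapping.single b 1)) \<in> rel_ideal (P_relations a)"
proof -
  obtain i j k where b: "b = ((i, j), k)"
    by (metis surj_pair)
  note simps = b P_op_def lin_add [OF lin_lin_ext] lin_scale [OF lin_lin_ext] lin_zero [OF lin_lin_ext]
    lin_diff [OF lin_lin_ext] lin_minus [OF lin_lin_ext] r_def [symmetric] s_def [symmetric] t_def [symmetric]
  show ?thesis
  proof (cases g)
    case Gen_r
    then show ?thesis
      by (simp add: simps mult.assoc pscale.subspace_0 [OF rel_ideal_subspace])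
  next
    case Gen_s
    have "s * r - pscale (- 1) (r * s) \<in> rel_ideal (P_relations a)"
      using rel_rs by (simp add: add.commute)
    then have "(s * r ^ i - pscale ((- 1) ^ i) (r ^ i * s)) * s ^ j * t ^ k \<in> rel_ideal (P_relations a)"
      by (intro rel_ideal_mult_right swap_power)
    then show ?thesis
      by (simp add: Gen_s simps pscale_algebra)
  next
    case Gen_t
    have c: "t ^ 2 * s ^ j - s ^ j * t ^ 2 \<in> rel_ideal (P_relations a)"
      using swap_power [of "t ^ 2" s 1 _ j] tt_s by simp
    let ?u = "if odd i then r ^ (i - 1) * t ^ 2 + pscale a (r ^ (i + 1)) else 0"
    let ?v = "if odd j then s ^ (j - 1) * t ^ 2 + pscale a (r ^ 2 * s ^ (j - 1)) + pscale 2 (s ^ (j + 1)) else 0"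
    (* First t passes the power of r, then the power of s; in the terms where an r has been
       replaced by a square of t, that square has to pass the power of s as well. *)
    have "t * P_basis b - lin_ext P_basis (P_op a Gen_t (Poly_Mapping.single b 1)) =
        (t * r ^ i - pscale ((- 1) ^ i) (r ^ i * t) - ?u) * (s ^ j * t ^ k)
         + pscale ((- 1) ^ i) (r ^ i * (t * s ^ j - pscale ((- 1) ^ j) (s ^ j * t) - ?v) * t ^ k)
         + (if odd i then r ^ (i - 1) * (t ^ 2 * s ^ j - s ^ j * t ^ 2) * t ^ k else 0)"
      by (auto simp: simps pscale_algebra power_add power_mult_commute)
    also have "\<dots> \<in> rel_ideal (P_relations a)"
      using c by (intro rel_ideal_closed t_r_power t_s_power)
        (auto intro: rel_ideal_closed pscale.subspace_0 [OF rel_ideal_subspace])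
    finally show ?thesis
      by (simp add: Gen_t t_def)
  qed
qed

end

text \<open>
  The vector to which \<open>p\<close> moves the basis vector of the monomial \<open>1\<close> consists of the coordinates
  of the class of \<open>p\<close> in the monomial basis.
\<close>
definition P_coords :: "'k::field \<Rightarrow> (rst, 'k) free_alg \<Rightarrow> ((nat \<times> nat) \<times> nat \<Rightarrow>\<^sub>0 'k)" where
  "P_coords a p = act (P_op a) p (Poly_Mapping.single ((0, 0), 0) 1)"

lemma lin_P_coords: "lin (P_coords a)"
  unfolding P_coords_def by (rule lin_act_left)

lemma P_coords_basis [simp]: "P_coords a (P_basis b) = Poly_Mapping.single b 1"
  by (simp add: P_coords_def act_P_basis)

lemma P_coords_lin_ext_basis: "P_coords a (lin_ext P_basis v) = v"
  by (rule lin_eqI [of "\<lambda>v. P_coords a (lin_ext P_basis v)" "\<lambda>v. v"])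
    (rule lin_comp [OF lin_lin_ext lin_P_coords], rule lin_id, simp)

lemma P_coords_eq_0_iff:
  assumes "a \<noteq> 1"
  shows "P_coords a p = 0 \<longleftrightarrow> p \<in> rel_ideal (P_relations a)"
proof
  assume "p \<in> rel_ideal (P_relations a)"
  then show "P_coords a p = 0"
    using act_rel_ideal [of "P_op a" "P_relations a" p] by (auto simp: P_coords_def lin_P_op P_op_relations)
next
  assume "P_coords a p = 0"
  moreover have "p - lin_ext P_basis (P_coords a p) \<in> rel_ideal (P_relations a)"
    unfolding P_coords_def
    by (rule normal_form_exists [OF lin_P_op _ P_straighten [OF assms]]) simp
  ultimately show "p \<in> rel_ideal (P_relations a)"
    by (simp add: lin_zero [OF lin_lin_ext])
qed

lemma P_coords_eq_iff: "a \<noteq> 1 \<Longrightarrow> P_coords a p = P_coords a q \<longleftrightarrow> cls (P_relations a) p = cls (P_relations a) q"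
  by (simp add: cls_eq_iff lin_diff [OF lin_P_coords] flip: P_coords_eq_0_iff)

definition P_class_coords :: "'k::field \<Rightarrow> (rst, 'k) free_alg set \<Rightarrow> ((nat \<times> nat) \<times> nat \<Rightarrow>\<^sub>0 'k)" where
  "P_class_coords a x = P_coords a (SOME p. x = cls (P_relations a) p)"

lemma P_class_coords_cls:
  assumes "a \<noteq> 1"
  shows "P_class_coords a (cls (P_relations a) p) = P_coords a p"
proof -
  have "cls (P_relations a) p = cls (P_relations a) (SOME q. cls (P_relations a) p = cls (P_relations a) q)"
    by (rule someI [of _ p]) simp
  then show ?thesis
    by (simp add: P_class_coords_def P_coords_eq_iff [OF assms])
qed

section \<open>The change of variables\<close>

definition linear_form :: "(rst \<Rightarrow> 'k::field) \<Rightarrow> (rst, 'k) free_alg" where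
  "linear_form v = pscale (v Gen_r) (gen Gen_r) + pscale (v Gen_s) (gen Gen_s) + pscale (v Gen_t) (gen Gen_t)"

text \<open>
  Quadratic elements are handled through their coefficient matrices, which turns identities between
  them into nine identities in the field.
\<close>
definition quadratic_form :: "(rst \<Rightarrow> rst \<Rightarrow> 'k::field) \<Rightarrow> (rst, 'k) free_alg" where
  "quadratic_form m =
    (let row = (\<lambda>g. pscale (m g Gen_r) (gen g * gen Gen_r) + pscale (m g Gen_s) (gen g * gen Gen_s)
        + pscale (m g Gen_t) (gen g * gen Gen_t))
     in row Gen_r + row Gen_s + row Gen_t)"

lemma linear_form_mult: "linear_form v * linear_form w = quadratic_form (\<lambda>g h. v g * w h)"
  by (simp add: linear_form_def quadratic_form_def pscale_algebra mult.commute add_ac)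

lemma
  shows quadratic_form_add: "quadratic_form m + quadratic_form n = quadratic_form (\<lambda>g h. m g h + n g h)"
    and quadratic_form_diff: "quadratic_form m - quadratic_form n = quadratic_form (\<lambda>g h. m g h - n g h)"
    and quadratic_form_minus: "- quadratic_form m = quadratic_form (\<lambda>g h. - m g h)"
    and quadratic_form_pscale: "pscale c (quadratic_form m) = quadratic_form (\<lambda>g h. c * m g h)"
  by (simp_all add: quadratic_form_def algebra_simps)

text \<open>
  These are the substitutions \<open>x = p + q\<close>, \<open>y = p - q\<close>,
  \<open>z = 2 c ((3 + e) r - (3 - e) s)\<close> with \<open>p = (1 + e) (3 - e) s - (1 - e) (3 + e) r\<close> and
  \<open>q = (3 - e) d (t - s)\<close>. They are scaled by a common factor that clears denominators. The flex
  tangent becomes \<open>c (x + y) - 2 z = 2 c (9 - e\<^sup>2) (s - r)\<close>, the harmonic polar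
  \<open>x - y = 2 q\<close>.
\<close>
fun xyz_coords :: "'k::field \<Rightarrow> 'k \<Rightarrow> 'k \<Rightarrow> xyz \<Rightarrow> rst \<Rightarrow> 'k" where
  "xyz_coords c e d Gen_x = (\<lambda>g. case g of
     Gen_r \<Rightarrow> - ((1 - e) * (3 + e)) | Gen_s \<Rightarrow> (3 - e) * (1 + e - d) | Gen_t \<Rightarrow> (3 - e) * d)"
| "xyz_coords c e d Gen_y = (\<lambda>g. case g of
     Gen_r \<Rightarrow> - ((1 - e) * (3 + e)) | Gen_s \<Rightarrow> (3 - e) * (1 + e + d) | Gen_t \<Rightarrow> - ((3 - e) * d))"
| "xyz_coords c e d Gen_z = (\<lambda>g. case g of
     Gen_r \<Rightarrow> 2 * c * (3 + e) | Gen_s \<Rightarrow> - (2 * c * (3 - e)) | Gen_t \<Rightarrow> 0)"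

definition xyz_to_rst :: "'k::field \<Rightarrow> 'k \<Rightarrow> 'k \<Rightarrow> xyz \<Rightarrow> (rst, 'k) free_alg" where
  "xyz_to_rst c e d g = linear_form (xyz_coords c e d g)"

text \<open>
  The inverse substitution. The parameters \<open>k\<close>, \<open>l\<close> and \<open>m\<close> stand for the reciprocals of
  \<open>4 c e (3 + e)\<close>, \<open>4 c e (3 - e)\<close> and \<open>2 (3 - e) d\<close>; kept as variables, they leave only
  polynomial identities to be verified.
\<close>
fun rst_to_xyz :: "'k::field \<Rightarrow> 'k \<Rightarrow> 'k \<Rightarrow> 'k \<Rightarrow> 'k \<Rightarrow> rst \<Rightarrow> (xyz, 'k) free_alg" where
  "rst_to_xyz c e k l m Gen_r = pscale k (pscale c (gen Gen_x + gen Gen_y) + pscale (1 + e) (gen Gen_z))"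
| "rst_to_xyz c e k l m Gen_s = pscale l (pscale c (gen Gen_x + gen Gen_y) + pscale (1 - e) (gen Gen_z))"
| "rst_to_xyz c e k l m Gen_t = pscale l (pscale c (gen Gen_x + gen Gen_y) + pscale (1 - e) (gen Gen_z))
    + pscale m (gen Gen_x - gen Gen_y)"

text \<open>
  A relation is labelled by the generator that is absent from its anticommutator.
\<close>
definition S_rel :: "'k::field \<Rightarrow> xyz \<Rightarrow> (xyz, 'k) free_alg" where
  "S_rel c g = (case g of
     Gen_x \<Rightarrow> gen Gen_y * gen Gen_z + gen Gen_z * gen Gen_y + pscale c (gen Gen_x ^ 2)
   | Gen_y \<Rightarrow> gen Gen_z * gen Gen_x + gen Gen_x * gen Gen_z + pscale c (gen Gen_y ^ 2)
   | Gen_z \<Rightarrow> gen Gen_x * gen Gen_y + gen Gen_y * gen Gen_x + pscale c (gen Gen_z ^ 2))"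

definition P_rel :: "'k::field \<Rightarrow> rst \<Rightarrow> (rst, 'k) free_alg" where
  "P_rel a g = (case g of
     Gen_t \<Rightarrow> gen Gen_r * gen Gen_s + gen Gen_s * gen Gen_r
   | Gen_s \<Rightarrow> gen Gen_t * gen Gen_r + gen Gen_r * gen Gen_t - gen Gen_t ^ 2 - pscale a (gen Gen_r ^ 2)
   | Gen_r \<Rightarrow> gen Gen_t * gen Gen_s + gen Gen_s * gen Gen_t - gen Gen_t ^ 2 - pscale a (gen Gen_r ^ 2)
       - pscale 2 (gen Gen_s ^ 2))"

lemma P_rel_quadratic_form:
  "P_rel a Gen_r = quadratic_form (\<lambda>g h. case (g, h) of
     (Gen_t, Gen_s) \<Rightarrow> 1 | (Gen_s, Gen_t) \<Rightarrow> 1 | (Gen_t, Gen_t) \<Rightarrow> - 1 | (Gen_r, Gen_r) \<Rightarrow> - a | (Gen_s, Gen_s) \<Rightarrow> - 2 | _ \<Rightarrow> 0)"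
  "P_rel a Gen_s = quadratic_form (\<lambda>g h. case (g, h) of
     (Gen_t, Gen_r) \<Rightarrow> 1 | (Gen_r, Gen_t) \<Rightarrow> 1 | (Gen_t, Gen_t) \<Rightarrow> - 1 | (Gen_r, Gen_r) \<Rightarrow> - a | _ \<Rightarrow> 0)"
  "P_rel a Gen_t = quadratic_form (\<lambda>g h. case (g, h) of
     (Gen_r, Gen_s) \<Rightarrow> 1 | (Gen_s, Gen_r) \<Rightarrow> 1 | _ \<Rightarrow> 0)"
  by (simp_all add: P_rel_def quadratic_form_def power2_eq_square algebra_simps)

text \<open>
  The two nets of conics match. Exchanging \<open>x\<close> and \<open>y\<close> amounts to changing the sign of
  \<open>d\<close>, which relates the first two formulas; the equations for \<open>d\<close> and \<open>a\<close> say that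
  \<open>q\<^sup>2\<close> is congruent to
  \<open>(3 + e)\<^sup>3 (1 - e) r\<^sup>2 + (3 - e)\<^sup>3 (1 + e) s\<^sup>2\<close>.
\<close>
lemma subst_S_rel:
  fixes a c d e :: "'k::field_char_0"
  assumes c: "c ^ 3 = (1 + e) * (1 - e)" and d: "d ^ 2 = - ((3 - e) * (1 + e))"
    and a: "(3 - e) ^ 3 * (1 + e) * a = (3 + e) ^ 3 * (1 - e)"
  defines "h \<equiv> xyz_to_rst c e d"
  shows "subst h (S_rel c Gen_x) =
      pscale (c * (3 + e) * (3 - e) * (3 + e ^ 2 + (3 - e) * d)) (P_rel a Gen_t)
      - pscale (c * (3 + e) * (3 - e) ^ 2 * d) (P_rel a Gen_s)
      + pscale (c * (3 - e) ^ 2 * ((3 - e) * (1 + e) + (3 + e) * d)) (P_rel a Gen_r)" (is ?x)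
    and "subst h (S_rel c Gen_y) =
      pscale (c * (3 + e) * (3 - e) * (3 + e ^ 2 - (3 - e) * d)) (P_rel a Gen_t)
      + pscale (c * (3 + e) * (3 - e) ^ 2 * d) (P_rel a Gen_s)
      + pscale (c * (3 - e) ^ 2 * ((3 - e) * (1 + e) - (3 + e) * d)) (P_rel a Gen_r)" (is ?y)
    and "subst h (S_rel c Gen_z) =
      - pscale (6 * (1 + e) * (1 - e) * (3 + e) * (3 - e)) (P_rel a Gen_t)
      - pscale (2 * (3 - e) ^ 3 * (1 + e)) (P_rel a Gen_r)" (is ?z)
proof -
  note simps = S_rel_def P_rel_quadratic_form h_def xyz_to_rst_def subst_add subst_pscale subst_mult subst_power
    power2_eq_square [of "linear_form _"] linear_form_mult quadratic_form_add quadratic_form_diff quadratic_form_minus quadratic_form_pscale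
  (* Below, induction on generators replaces a case distinction: it leaves no premises about
     generators, which the Groebner basis method would try to use as equations. *)
  note cases = prod.case rst.case xyz_coords.simps
  show ?x
    unfolding simps xyz.case subst_gen
  proof (rule arg_cong [where f = quadratic_form], intro ext, goal_cases)
    case (1 g g')
    show ?case
      by (induction g; induction g'; simp only: cases; ((insert d a, Groebner_Basis.algebra) | (simp add: algebra_simps power2_eq_square)))
  qed
  show ?y
    unfolding simps xyz.case subst_gen
  proof (rule arg_cong [where f = quadratic_form], intro ext, goal_cases)
    case (1 g g')
    show ?case
      by (induction g; induction g'; simp only: cases; ((insert d a, Groebner_Basis.algebra) | (simp add: algebra_simps power2_eq_square)))
  qed
  show ?z
    unfolding simps xyz.case subst_gen
  proof (rule arg_cong [where f = quadratic_form], intro ext, goal_cases)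
    case (1 g g')
    show ?case
      by (induction g; induction g'; simp only: cases; ((insert c d a, Groebner_Basis.algebra) | (simp add: algebra_simps power2_eq_square)))
  qed
qed

lemma S11_relations_S_rel: "S11_relations c = range (S_rel c)"
proof -
  have U: "UNIV = {Gen_x, Gen_y, Gen_z}"
    using xyz.exhaust by auto
  have "range (S_rel c) = {S_rel c Gen_x, S_rel c Gen_y, S_rel c Gen_z}"
    unfolding U by simp
  then show ?thesis
    by (simp add: S11_relations_def S_rel_def Let_def scalar_times)
qed

lemma P_rel_in_ideal: "P_rel a g \<in> rel_ideal (P_relations a)"
  by (rule P_relations_ideal) (cases g; simp add: P_rel_def)

lemma P_relations_P_rel: "P_relations a = {P_rel a Gen_t, P_rel a Gen_s, P_rel a Gen_s - P_rel a Gen_r}"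
  by (simp add: P_relations_def P_rel_def Let_def scalar_times algebra_simps)

text \<open>
  It remains to see that the inverse substitution \<open>h'\<close> respects the ideals as well. Since \<open>h'\<close>
  undoes \<open>h\<close>, it maps the elements \<open>subst h (S_rel c g)\<close> into the ideal of \<open>S(1,1,c)\<close>, and these
  three combinations of the relations of \<open>P(a)\<close> can be solved for the latter, one after the other.
\<close>
lemma S11_P_isomorphic:
  fixes a c d e :: "'k::field_char_0"
  assumes c: "c ^ 3 = (1 + e) * (1 - e)" and d: "d ^ 2 = - ((3 - e) * (1 + e))"
    and a: "(3 - e) ^ 3 * (1 + e) * a = (3 + e) ^ 3 * (1 - e)"
    and nz: "c \<noteq> 0" "d \<noteq> 0" "e \<noteq> 0" "3 + e \<noteq> 0" "3 - e \<noteq> 0" "1 + e \<noteq> 0"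
  shows "graded_isomorphic (S11_algebra c) (P_algebra a)"
proof -
  define h where "h = xyz_to_rst c e d"
  obtain k where k: "4 * c * e * (3 + e) * k = 1"
    using nz by (metis mult_eq_0_iff right_inverse zero_neq_numeral)
  obtain l where l: "4 * c * e * (3 - e) * l = 1"
    using nz by (metis mult_eq_0_iff right_inverse zero_neq_numeral)
  obtain m where m: "2 * (3 - e) * d * m = 1"
    using nz by (metis mult_eq_0_iff right_inverse zero_neq_numeral)
  define h' where "h' = rst_to_xyz c e k l m"
  note rel = subst_S_rel [OF c d a, folded h_def]
  let ?P = "P_rel a" and ?S = "S_rel c"
  note simps = h_def xyz_to_rst_def linear_form_def h'_def rst_to_xyz.simps xyz_coords.simps rst.case
    subst_add subst_diff subst_pscale subst_gen lookup_add lookup_minus lookup_pscale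
  have h'h: "subst h' (h g) = gen g" for g
  proof (rule poly_mapping_eqI)
    fix w
    show "Poly_Mapping.lookup (subst h' (h g)) w = Poly_Mapping.lookup (gen g) w"
      by (induction g; simp only: simps; insert k l m; Groebner_Basis.algebra)
  qed
  have hh': "subst h (h' g) = gen g" for g
  proof (rule poly_mapping_eqI)
    fix w
    show "Poly_Mapping.lookup (subst h (h' g)) w = Poly_Mapping.lookup (gen g) w"
      by (induction g; simp only: simps; insert k l m; Groebner_Basis.algebra)
  qed
  have P_in: "?P g \<in> {p. subst h' p \<in> rel_ideal (range ?S)}" (is "_ \<in> ?J") for g
  proof -
    have J: "pscale.subspace ?J"
      using rel_ideal_subspace [of "range ?S"]
      by (auto simp: pscale.subspace_def lin_zero [OF lin_subst] subst_add subst_pscale)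
    have J_cancel: "p \<in> ?J" if "pscale k p \<in> ?J" "k \<noteq> 0" for k p
      using pscale.subspace_scale [OF J that(1), of "inverse k"] that(2) by simp
    have hS: "subst h (?S g) \<in> ?J" for g
      by (simp add: subst_subst h'h rel_ideal_base)
    have "pscale (8 * c * (3 + e) * (3 - e) * e ^ 2) (?P Gen_t)
        = subst h (?S Gen_x) + subst h (?S Gen_y) + pscale c (subst h (?S Gen_z))"
      unfolding rel by (rule poly_mapping_eqI)
        (simp add: lookup_add lookup_minus algebra_simps power2_eq_square power3_eq_cube)
    also have "\<dots> \<in> ?J"
      by (intro pscale.subspace_add [OF J] pscale.subspace_scale [OF J] hS)
    finally have t: "?P Gen_t \<in> ?J"
      by (rule J_cancel) (use nz in simp)
    have "pscale (2 * (3 - e) ^ 3 * (1 + e)) (?P Gen_r)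
        = - subst h (?S Gen_z) - pscale (6 * (1 + e) * (1 - e) * (3 + e) * (3 - e)) (?P Gen_t)"
      unfolding rel by simp
    also have "\<dots> \<in> ?J"
      by (intro pscale.subspace_diff [OF J] pscale.subspace_neg [OF J] pscale.subspace_scale [OF J] hS t)
    finally have r: "?P Gen_r \<in> ?J"
      by (rule J_cancel) (use nz in simp)
    have "pscale (2 * c * (3 + e) * (3 - e) ^ 2 * d) (?P Gen_s)
        = pscale (2 * c * (3 + e) * (3 - e) ^ 2 * d) (?P Gen_t + ?P Gen_r) - (subst h (?S Gen_x) - subst h (?S Gen_y))"
      unfolding rel by (rule poly_mapping_eqI)
        (simp add: lookup_add lookup_minus algebra_simps power2_eq_square power3_eq_cube)
    also have "\<dots> \<in> ?J"
      by (intro pscale.subspace_diff [OF J] pscale.subspace_add [OF J] pscale.subspace_scale [OF J] hS t r)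
    finally have s: "?P Gen_s \<in> ?J"
      by (rule J_cancel) (use nz in simp)
    show "?P g \<in> ?J"
      using r s t by (cases g) simp_all
  qed
  show ?thesis
    unfolding S11_algebra_def P_algebra_def S11_relations_S_rel
  proof (rule graded_isomorphic_presented_algebra)
    fix p assume "p \<in> range ?S"
    then obtain g where "p = ?S g"
      by blast
    moreover have "subst h (?S g) \<in> rel_ideal (P_relations a)"
      by (cases g; simp only: rel; intro pscale.subspace_diff pscale.subspace_add pscale.subspace_neg
          pscale.subspace_scale rel_ideal_subspace P_rel_in_ideal)
    ultimately show "subst h p \<in> rel_ideal (P_relations a)"
      by simp
  next
    fix p assume "p \<in> P_relations a"
    then show "subst h' p \<in> rel_ideal (range ?S)"
      using P_in by (auto simp: P_relations_P_rel subst_diff intro!: pscale.subspace_diff rel_ideal_subspace)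
  next
    show "homogeneous 1 (h g)" for g
      unfolding h_def xyz_to_rst_def linear_form_def
      by (intro homogeneous_add homogeneous_pscale homogeneous_gen)
  qed (fact h'h hh')+
qed

text \<open>
  For \<open>c \<noteq> 0\<close>, the cases excluded by type EC are visible in terms of \<open>e\<close>: the point scheme is
  singular for \<open>c\<^sup>3 = 1\<close>, where \<open>e = 0\<close>, and for \<open>c\<^sup>3 = - 8\<close>, where \<open>e\<^sup>2 = 9\<close>.
\<close>
lemma type_EC_parameters:
  fixes c :: "'k::{alg_closed_field, field_char_0}"
  assumes "type_EC c"
  obtains d e where "c ^ 3 = (1 + e) * (1 - e)" "d ^ 2 = - ((3 - e) * (1 + e))"
    "c \<noteq> 0" "d \<noteq> 0" "e \<noteq> 0" "3 + e \<noteq> 0" "3 - e \<noteq> 0" "1 + e \<noteq> 0" "1 - e \<noteq> 0"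
proof -
  obtain e where e: "e ^ 2 = 1 - c ^ 3"
    using nth_root_exists [of 2 "1 - c ^ 3"] by auto
  obtain d where d: "d ^ 2 = - ((3 - e) * (1 + e))"
    using nth_root_exists [of 2 "- ((3 - e) * (1 + e))"] by auto
  have ec: "c \<noteq> 0" "(3 * c) ^ 3 \<noteq> (2 + c ^ 3) ^ 3"
    using assms by (simp_all add: type_EC_iff)
  have c: "c ^ 3 = (1 + e) * (1 - e)"
    using e by (simp add: algebra_simps power2_eq_square)
  then have 1: "1 + e \<noteq> 0" "1 - e \<noteq> 0"
    using ec(1) by auto
  have "(3 * c) ^ 3 - (2 + c ^ 3) ^ 3 = e ^ 4 * (e ^ 2 - 9)"
  proof -
    have "(3 * c) ^ 3 = 27 * c ^ 3"
      by (simp add: power_mult_distrib)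
    then show ?thesis
      unfolding c by Groebner_Basis.algebra
  qed
  then have 2: "e \<noteq> 0" "e ^ 2 \<noteq> 9"
    using ec(2) by auto
  then have "(3 + e) * (3 - e) \<noteq> 0"
    by (simp add: algebra_simps power2_eq_square)
  then have 3: "3 + e \<noteq> 0" "3 - e \<noteq> 0"
    by auto
  then have "d \<noteq> 0"
    using d 1 by auto
  with 1 2 3 c d ec(1) that show thesis
    by blast
qed

section \<open>Tensor products of spaces with bases\<close>

lemma free_space_simps [simp]:
  "carrier (free_space V) = {p. Poly_Mapping.keys p \<subseteq> V}" "zero (free_space V) = 0"
  "add (free_space V) = (+)" "module.smult (free_space V) = pscale"
  by (simp_all add: free_space_def pscale_def fun_eq_iff)

lemma keys_subset_iff: "Poly_Mapping.keys p \<subseteq> V \<longleftrightarrow> (\<forall>x. x \<notin> V \<longrightarrow> Poly_Mapping.lookup p x = 0)"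
  by (auto simp: in_keys_iff)

lemma supported_subspace: "pscale.subspace {p :: 'a \<Rightarrow>\<^sub>0 'k::field. Poly_Mapping.keys p \<subseteq> V}"
  by (simp add: keys_subset_iff pscale.subspace_def lookup_add)

lemma submodule_free_space_iff:
  "submodule N (scalars :: 'k::field ring) (free_space V) \<longleftrightarrow> pscale.subspace N \<and> (\<forall>p\<in>N. Poly_Mapping.keys p \<subseteq> V)"
proof -
  interpret F: module "scalars :: 'k ring" "free_space V"
  proof (rule moduleI)
    show "cring (scalars :: 'k ring)"
      by (rule cring_from_type_algebra)
    show "abelian_group (free_space V :: ('k, 'a \<Rightarrow>\<^sub>0 'k) module)"
      by (rule abelian_groupI)
        (auto simp: add_ac keys_subset_iff lookup_add intro!: exI [of _ "- _"])
  qed (auto simp: keys_subset_iff pscale.scale_left_distrib pscale.scale_right_distrib)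
  have neg: "\<ominus>\<^bsub>free_space V\<^esub> p = - p" if "Poly_Mapping.keys p \<subseteq> V" for p :: "'a \<Rightarrow>\<^sub>0 'k"
    by (rule F.minus_equality) (use that in simp_all)
  show ?thesis
  proof
    assume N: "submodule N (scalars :: 'k ring) (free_space V)"
    then interpret N: submodule N "scalars :: 'k ring" "free_space V" .
    show "pscale.subspace N \<and> (\<forall>p\<in>N. Poly_Mapping.keys p \<subseteq> V)"
      using F.submoduleE [OF N] N.one_closed by (auto simp: pscale.subspace_def)
  next
    assume N: "pscale.subspace N \<and> (\<forall>p\<in>N. Poly_Mapping.keys p \<subseteq> V)"
    show "submodule N (scalars :: 'k ring) (free_space V)"
    proof (rule F.submoduleI)
      fix p assume "p \<in> N"
      moreover from this have "Poly_Mapping.keys p \<subseteq> V"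
        using N by blast
      ultimately show "\<ominus>\<^bsub>free_space V\<^esub> p \<in> N"
        using N by (simp add: neg pscale.subspace_neg)
    qed (use N in \<open>auto intro: pscale.subspace_0 pscale.subspace_add pscale.subspace_scale\<close>)
  qed
qed

text \<open>
  Submodules of a free space are subspaces of the ambient space of finitely supported functions, so
  the relations of the tensor product generate their ordinary linear span.
\<close>
lemma tensor_null_eq_span:
  assumes "module (scalars :: 'k::field ring) A" "module (scalars :: 'k ring) B"
  shows "tensor_null A B = pscale.span (tensor_relations A B)"
proof -
  interpret A: module "scalars :: 'k ring" A by fact
  interpret B: module "scalars :: 'k ring" B by fact
  let ?V = "{p :: _ \<Rightarrow>\<^sub>0 'k. Poly_Mapping.keys p \<subseteq> carrier A \<times> carrier B}"
  have "tensor_relations A B \<subseteq> ?V"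
    by (auto simp: tensor_relations_def keys_subset_iff lookup_minus lookup_single when_def)
  then have "pscale.span (tensor_relations A B) \<subseteq> ?V"
    by (rule pscale.span_minimal [OF _ supported_subspace])
  then show ?thesis
    unfolding tensor_null_def generated_submodule_def submodule_free_space_iff
    by (auto intro: pscale.span_base dest: pscale.span_minimal)
qed

lemma generated_submodule_induct [consumes 3, case_names base add smult zero]:
  assumes "x \<in> generated_submodule M S"
  assumes M: "module (scalars :: 'k::field ring) M" and S: "S \<subseteq> carrier M"
    and base: "\<And>x. x \<in> S \<Longrightarrow> P x"
    and add: "\<And>x y. x \<in> carrier M \<Longrightarrow> y \<in> carrier M \<Longrightarrow> P x \<Longrightarrow> P y \<Longrightarrow> P (x \<oplus>\<^bsub>M\<^esub> y)"
    and smult: "\<And>c x. x \<in> carrier M \<Longrightarrow> P x \<Longrightarrow> P (c \<odot>\<^bsub>M\<^esub> x)"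
    and zero: "P \<zero>\<^bsub>M\<^esub>"
  shows "P x"
proof -
  interpret M: module "scalars :: 'k ring" M by fact
  have "submodule {x \<in> carrier M. P x} (scalars :: 'k ring) M"
  proof (rule M.submoduleI)
    fix x assume x: "x \<in> {x \<in> carrier M. P x}"
    have "\<ominus>\<^bsub>M\<^esub> x = (- 1) \<odot>\<^bsub>M\<^esub> x"
      using x M.smult_l_distr [of "- 1" 1 x] M.smult_one [of x] M.smult_l_null [of x]
      by (intro M.minus_equality) simp_all
    then show "\<ominus>\<^bsub>M\<^esub> x \<in> {x \<in> carrier M. P x}"
      using x smult by auto
  qed (use zero add smult in auto)
  then show ?thesis
    using assms(1) S base by (auto simp: generated_submodule_def)
qed

text \<open>\<close>
text \<open>
  Let \<open>u\<close> and \<open>w\<close> span \<open>A\<close> and \<open>B\<close>, and let a bilinear map \<open>\<mu>\<close> into \<open>C\<close> send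
  the pairs \<open>(u i, w j)\<close> to a basis, with coordinate map \<open>\<theta>\<close>. Then \<open>\<mu>\<close> induces an isomorphism
  from the tensor product. The bilinear extension \<open>\<Phi>\<close> kills the tensor relations. Its section
  \<open>\<Psi>\<close> sends a basis vector to the pure tensor of \<open>u i\<close> and \<open>w j\<close>, so \<open>\<Phi>\<close> is surjective.
  It is injective modulo the relations since every \<open>p\<close> is congruent to \<open>\<Psi> (\<Phi> p)\<close>: this holds for
  the pairs \<open>(u i, w j)\<close>, and it extends to all pairs by bilinearity.
\<close>
lemma tensor_product_iso_if_basis:
  fixes A :: "('k::field, 'a, 'm) module_scheme" and B :: "('k, 'b, 'n) module_scheme"
    and C :: "('k, 'c, 'o) module_scheme" and \<theta> :: "'c \<Rightarrow> ('i \<times> 'j \<Rightarrow>\<^sub>0 'k)"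
  assumes A: "module (scalars :: 'k ring) A" and B: "module (scalars :: 'k ring) B" and C: "module (scalars :: 'k ring) C"
    and u: "range u \<subseteq> carrier A" "carrier A \<subseteq> generated_submodule A (range u)"
    and w: "range w \<subseteq> carrier B" "carrier B \<subseteq> generated_submodule B (range w)"
    and \<theta>: "linear_iso C (free_space UNIV) \<theta>"
    and \<mu>_closed: "\<And>a b. a \<in> carrier A \<Longrightarrow> b \<in> carrier B \<Longrightarrow> \<mu> a b \<in> carrier C"
    and \<mu>_add: "\<And>a a' b. a \<in> carrier A \<Longrightarrow> a' \<in> carrier A \<Longrightarrow> b \<in> carrier B \<Longrightarrow> \<mu> (a \<oplus>\<^bsub>A\<^esub> a') b = \<mu> a b \<oplus>\<^bsub>C\<^esub> \<mu> a' b"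
       "\<And>a b b'. a \<in> carrier A \<Longrightarrow> b \<in> carrier B \<Longrightarrow> b' \<in> carrier B \<Longrightarrow> \<mu> a (b \<oplus>\<^bsub>B\<^esub> b') = \<mu> a b \<oplus>\<^bsub>C\<^esub> \<mu> a b'"
    and \<mu>_smult: "\<And>c a b. a \<in> carrier A \<Longrightarrow> b \<in> carrier B \<Longrightarrow> \<mu> (c \<odot>\<^bsub>A\<^esub> a) b = c \<odot>\<^bsub>C\<^esub> \<mu> a b"
       "\<And>c a b. a \<in> carrier A \<Longrightarrow> b \<in> carrier B \<Longrightarrow> \<mu> a (c \<odot>\<^bsub>B\<^esub> b) = c \<odot>\<^bsub>C\<^esub> \<mu> a b"
    and basis: "\<And>i j. \<theta> (\<mu> (u i) (w j)) = Poly_Mapping.single (i, j) 1"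
  shows "\<exists>\<phi>. linear_iso (tensor_product A B) C \<phi> \<and>
      (\<forall>a\<in>carrier A. \<forall>b\<in>carrier B. \<phi> (pure_tensor A B a b) = \<mu> a b)"
proof -
  interpret A: module "scalars :: 'k ring" A by fact
  interpret B: module "scalars :: 'k ring" B by fact
  interpret C: module "scalars :: 'k ring" C by fact
  let ?F = "{p :: 'a \<times> 'b \<Rightarrow>\<^sub>0 'k. Poly_Mapping.keys p \<subseteq> carrier A \<times> carrier B}"
  define N where "N = tensor_null A B"
  have N_span: "N = pscale.span (tensor_relations A B)"
    by (simp add: N_def tensor_null_eq_span [OF A B])
  have N: "pscale.subspace N"
    by (simp add: N_span)
  define \<theta>' where "\<theta>' = inv_into (carrier C) \<theta>"
  have \<theta>': "\<theta>' m \<in> carrier C" "\<theta> (\<theta>' m) = m" for m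
    using \<theta> bij_betw_inv_into_right [of \<theta> "carrier C" UNIV m]
    by (auto simp: linear_iso_def \<theta>'_def bij_betw_def inv_into_into)
  have \<theta>_inj: "x \<in> carrier C \<Longrightarrow> y \<in> carrier C \<Longrightarrow> \<theta> x = \<theta> y \<Longrightarrow> x = y" for x y
    using \<theta> by (auto simp: linear_iso_def bij_betw_def dest: inj_onD)
  have \<theta>_lin: "x \<in> carrier C \<Longrightarrow> y \<in> carrier C \<Longrightarrow> \<theta> (x \<oplus>\<^bsub>C\<^esub> y) = \<theta> x + \<theta> y"
      "x \<in> carrier C \<Longrightarrow> \<theta> (c \<odot>\<^bsub>C\<^esub> x) = pscale c (\<theta> x)" for x y c
    using \<theta> by (auto simp: linear_iso_def)
  define \<Phi> where "\<Phi> = lin_ext (\<lambda>(a, b). \<theta> (\<mu> a b))"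
  have lin\<Phi>: "lin \<Phi>"
    by (simp add: \<Phi>_def lin_lin_ext)
  have \<Phi>_single: "\<Phi> (Poly_Mapping.single (a, b) c) = pscale c (\<theta> (\<mu> a b))" for a b c
    by (simp add: \<Phi>_def)
  have \<Phi>_N: "\<Phi> p = 0" if "p \<in> N" for p
    using that unfolding N_span
  proof (induction p rule: pscale.span_induct)
    case base
    show ?case
      by (simp add: pscale.subspace_def lin_zero [OF lin\<Phi>] lin_add [OF lin\<Phi>] lin_scale [OF lin\<Phi>])
  next
    case (step p)
    then show ?case
      unfolding tensor_relations_def
      by (auto simp: lin_diff [OF lin\<Phi>] \<Phi>_single \<mu>_add \<mu>_smult \<theta>_lin \<mu>_closed)
  qed
  define \<Psi> where "\<Psi> = lin_ext (\<lambda>(i, j). Poly_Mapping.single (u i, w j) (1 :: 'k))"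
  have lin\<Psi>: "lin \<Psi>"
    by (simp add: \<Psi>_def lin_lin_ext)
  have \<Psi>_F: "\<Psi> m \<in> ?F" for m
    unfolding \<Psi>_def using u(1) w(1) by (intro lin_ext_in_subspace supported_subspace) auto
  have \<Phi>\<Psi>: "\<Phi> (\<Psi> m) = m" for m
    by (rule lin_eqI [of "\<lambda>m. \<Phi> (\<Psi> m)" "\<lambda>m. m"])
      (rule lin_comp [OF lin\<Psi> lin\<Phi>], rule lin_id, auto simp: \<Psi>_def \<Phi>_single basis)
  let ?G = "{p. p - \<Psi> (\<Phi> p) \<in> N}"
  have G: "pscale.subspace ?G"
  proof (rule pscale.subspaceI)
    show "0 \<in> ?G"
      by (simp add: lin_zero [OF lin\<Phi>] lin_zero [OF lin\<Psi>] pscale.subspace_0 [OF N])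
    show "p + q \<in> ?G" if "p \<in> ?G" "q \<in> ?G" for p q
      using that pscale.subspace_add [OF N, of "p - \<Psi> (\<Phi> p)" "q - \<Psi> (\<Phi> q)"]
      by (simp add: lin_add [OF lin\<Phi>] lin_add [OF lin\<Psi>] algebra_simps)
    show "pscale c p \<in> ?G" if "p \<in> ?G" for c p
      using that pscale.subspace_scale [OF N, of "p - \<Psi> (\<Phi> p)" c]
      by (simp add: lin_scale [OF lin\<Phi>] lin_scale [OF lin\<Psi>] pscale.scale_right_diff_distrib)
  qed
  have N_G: "N \<subseteq> ?G"
    by (auto simp: \<Phi>_N lin_zero [OF lin\<Psi>])
  have rel_G: "p \<in> ?G" if "p - q \<in> tensor_relations A B" "q \<in> ?G" for p q
  proof -
    have "p - q \<in> ?G"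
      using that(1) N_G pscale.span_base unfolding N_span by blast
    from pscale.subspace_add [OF G this that(2)] show ?thesis
      by simp
  qed
  let ?e = "\<lambda>a b. Poly_Mapping.single (a, b) (1 :: 'k)"
  have smult_G: "Poly_Mapping.single (a, b) c \<in> ?G" if "?e a b \<in> ?G" for a b c
    using pscale.subspace_scale [OF G that, of c] by simp
  have e_G1: "?e a (w j) \<in> ?G" if "a \<in> carrier A" for a j
  proof -
    have b: "w j \<in> carrier B"
      using w(1) by blast
    from that u(2) have "a \<in> generated_submodule A (range u)"
      by blast
    from this A u(1) show ?thesis
    proof (induction a rule: generated_submodule_induct)
      case (base a)
      then obtain i where a: "a = u i"
        by blast
      have "\<Psi> (\<Phi> (?e a (w j))) = ?e a (w j)"
        by (simp add: a \<Phi>_single basis) (simp add: \<Psi>_def)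
      then show ?case
        by (simp add: pscale.subspace_0 [OF N])
    next
      case (add x y)
      show ?case
        by (rule rel_G [OF _ pscale.subspace_add [OF G add(3,4)]])
          (use add(1,2) b in \<open>auto simp: tensor_relations_def simp flip: diff_diff_eq\<close>)
    next
      case (smult c x)
      show ?case
        by (rule rel_G [OF _ smult_G [OF smult(2), of c]]) (use smult(1) b in \<open>auto simp: tensor_relations_def\<close>)
    next
      case zero
      have "?e (0 \<odot>\<^bsub>A\<^esub> \<zero>\<^bsub>A\<^esub>) (w j) - Poly_Mapping.single (\<zero>\<^bsub>A\<^esub>, w j) 0 \<in> tensor_relations A B"
        unfolding tensor_relations_def using A.zero_closed b by blast
      then have "?e (0 \<odot>\<^bsub>A\<^esub> \<zero>\<^bsub>A\<^esub>) (w j) \<in> ?G"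
        by (rule rel_G) (simp add: pscale.subspace_0 [OF G] del: mem_Collect_eq)
      then show ?case
        using A.smult_l_null [of "\<zero>\<^bsub>A\<^esub>"] by simp
    qed
  qed
  have e_G: "?e a b \<in> ?G" if a: "a \<in> carrier A" and b: "b \<in> carrier B" for a b
  proof -
    from b w(2) have "b \<in> generated_submodule B (range w)"
      by blast
    from this B w(1) show ?thesis
    proof (induction b rule: generated_submodule_induct)
      case (base b)
      then show ?case
        using e_G1 [OF a] by blast
    next
      case (add x y)
      show ?case
        by (rule rel_G [OF _ pscale.subspace_add [OF G add(3,4)]])
          (use add(1,2) a in \<open>auto simp: tensor_relations_def simp flip: diff_diff_eq\<close>)
    next
      case (smult c x)
      show ?case
        by (rule rel_G [OF _ smult_G [OF smult(2), of c]]) (use smult(1) a in \<open>auto simp: tensor_relations_def\<close>)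
    next
      case zero
      have "?e a (0 \<odot>\<^bsub>B\<^esub> \<zero>\<^bsub>B\<^esub>) - Poly_Mapping.single (a, \<zero>\<^bsub>B\<^esub>) 0 \<in> tensor_relations A B"
        unfolding tensor_relations_def using B.zero_closed a by blast
      then have "?e a (0 \<odot>\<^bsub>B\<^esub> \<zero>\<^bsub>B\<^esub>) \<in> ?G"
        by (rule rel_G) (simp add: pscale.subspace_0 [OF G] del: mem_Collect_eq)
      then show ?case
        using B.smult_l_null [of "\<zero>\<^bsub>B\<^esub>"] by simp
    qed
  qed
  have F_G: "?F \<subseteq> ?G"
  proof
    fix p assume p: "p \<in> ?F"
    have "(\<Sum>x\<in>Poly_Mapping.keys p. Poly_Mapping.single x (Poly_Mapping.lookup p x)) \<in> ?G"
    proof (rule pscale.subspace_sum [OF G])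
      fix x assume "x \<in> Poly_Mapping.keys p"
      then obtain a b where x: "x = (a, b)" "a \<in> carrier A" "b \<in> carrier B"
        using p by auto
      show "Poly_Mapping.single x (Poly_Mapping.lookup p x) \<in> ?G"
        unfolding x(1) by (rule smult_G [OF e_G [OF x(2,3)]])
    qed
    then show "p \<in> ?G"
      by (simp flip: poly_mapping_sum_single)
  qed
  define \<phi> where "\<phi> V = \<theta>' (\<Phi> (SOME p. p \<in> V))" for V
  have \<phi>: "\<phi> (coset N p) = \<theta>' (\<Phi> p)" for p
  proof -
    have "0 + p \<in> coset N p"
      unfolding coset_def using pscale.subspace_0 [OF N] by blast
    then have "(SOME q. q \<in> coset N p) \<in> coset N p"
      by (rule someI)
    then have "\<Phi> ((SOME q. q \<in> coset N p) - p) = 0"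
      by (intro \<Phi>_N) (auto simp: coset_def)
    then show ?thesis
      by (simp add: \<phi>_def lin_diff [OF lin\<Phi>])
  qed
  have carrier: "carrier (tensor_product A B) = coset N ` ?F"
    by (simp add: tensor_product_def quotient_space_def N_def a_rcosets_coset)
  have "linear_iso (tensor_product A B) C \<phi>"
    unfolding linear_iso_def
  proof (intro conjI ballI allI)
    show "bij_betw \<phi> (carrier (tensor_product A B)) (carrier C)"
      unfolding carrier
    proof (rule bij_betwI')
      fix U V assume "U \<in> coset N ` ?F" "V \<in> coset N ` ?F"
      then obtain p q where U: "U = coset N p" "V = coset N q" "p \<in> ?F" "q \<in> ?F"
        by blast
      have "p - q \<in> ?F"
        by (rule pscale.subspace_diff [OF supported_subspace U(3,4)])
      then have pq: "p - q \<in> ?G"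
        using F_G by (rule rev_subsetD)
      show "(\<phi> U = \<phi> V) = (U = V)"
      proof
        assume "\<phi> U = \<phi> V"
        then have "\<Phi> (p - q) = 0"
          unfolding U(1,2) \<phi> by (metis \<theta>'(2) lin_diff [OF lin\<Phi>] eq_iff_diff_eq_0)
        then show "U = V"
          using pq by (simp add: U(1,2) coset_eq_iff [OF N] lin_zero [OF lin\<Psi>])
      qed simp
    next
      show "\<phi> U \<in> carrier C" if "U \<in> coset N ` ?F" for U
        using that by (auto simp: \<phi> \<theta>')
    next
      fix z assume z: "z \<in> carrier C"
      have "z = \<phi> (coset N (\<Psi> (\<theta> z)))"
        unfolding \<phi> \<Phi>\<Psi> by (rule \<theta>_inj) (simp_all add: z \<theta>')
      then show "\<exists>U\<in>coset N ` ?F. z = \<phi> U"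
        using \<Psi>_F by blast
    qed
  next
    fix U V assume "U \<in> carrier (tensor_product A B)" "V \<in> carrier (tensor_product A B)"
    then obtain p q where U: "U = coset N p" "V = coset N q"
      unfolding carrier by blast
    have "U \<oplus>\<^bsub>tensor_product A B\<^esub> V = coset N (p + q)"
      unfolding U by (simp add: tensor_product_def quotient_space_def set_add_coset N)
    then show "\<phi> (U \<oplus>\<^bsub>tensor_product A B\<^esub> V) = \<phi> U \<oplus>\<^bsub>C\<^esub> \<phi> V"
      by (simp add: U \<phi>, intro \<theta>_inj) (simp_all add: \<theta>' \<theta>_lin lin_add [OF lin\<Phi>])
  next
    fix c U assume "U \<in> carrier (tensor_product A B)"
    then obtain p where U: "U = coset N p"
      unfolding carrier by blast
    have "c \<odot>\<^bsub>tensor_product A B\<^esub> U = coset N (pscale c p)"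
      unfolding U by (simp add: tensor_product_def quotient_space_def coset_smult_coset N flip: N_def)
    then show "\<phi> (c \<odot>\<^bsub>tensor_product A B\<^esub> U) = c \<odot>\<^bsub>C\<^esub> \<phi> U"
      by (simp add: U \<phi>, intro \<theta>_inj) (simp_all add: \<theta>' \<theta>_lin lin_scale [OF lin\<Phi>])
  qed
  moreover have "\<phi> (pure_tensor A B a b) = \<mu> a b" if "a \<in> carrier A" "b \<in> carrier B" for a b
    using that unfolding pure_tensor_def
    by (simp add: a_r_coset_coset \<phi> \<Phi>_single flip: N_def) (intro \<theta>_inj, simp_all add: \<theta>' \<mu>_closed)
  ultimately show ?thesis
    by blast
qed

section \<open>The two factors\<close>

fun skew_basis :: "nat \<times> nat \<Rightarrow> (rs, 'k::field) free_alg" where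
  "skew_basis (i, j) = gen Skew_r ^ i * gen Skew_s ^ j"

fun skew_basis_op :: "rs \<Rightarrow> nat \<times> nat \<Rightarrow> (nat \<times> nat \<Rightarrow>\<^sub>0 'k::field)" where
  "skew_basis_op Skew_r (i, j) = Poly_Mapping.single (i + 1, j) 1"
| "skew_basis_op Skew_s (i, j) = Poly_Mapping.single (i, j + 1) ((- 1) ^ i)"

text \<open>
  Independence of the monomials \<open>r\<^sup>i s\<^sup>j\<close> follows later from that of their images in
  \<open>P(a)\<close>.
\<close>
lemma skew_spanning:
  "\<exists>v. p - lin_ext skew_basis v \<in> rel_ideal (skew_relations :: (rs, 'k::field) free_alg set)"
proof -
  let ?r = "gen Skew_r :: (rs, 'k) free_alg" and ?s = "gen Skew_s :: (rs, 'k) free_alg"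
  let ?T = "\<lambda>g. lin_ext (skew_basis_op g) :: (nat \<times> nat \<Rightarrow>\<^sub>0 'k) \<Rightarrow> _"
  have "?r * ?s + ?s * ?r \<in> rel_ideal skew_relations"
    by (rule rel_ideal_base) (simp add: skew_relations_def)
  then have sr: "?s * ?r - pscale (- 1) (?r * ?s) \<in> rel_ideal skew_relations"
    by (simp add: add.commute)
  have "p - lin_ext skew_basis (act ?T p (Poly_Mapping.single (0, 0) 1)) \<in> rel_ideal skew_relations"
  proof (rule normal_form_exists)
    show "gen g * skew_basis b - lin_ext skew_basis (?T g (Poly_Mapping.single b 1)) \<in> rel_ideal skew_relations"
      for g b
    proof (cases b; cases g)
      fix i j assume b: "b = (i, j)" and g: "g = Skew_s"
      have "(?s * ?r ^ i - pscale ((- 1) ^ i) (?r ^ i * ?s)) * ?s ^ j \<in> rel_ideal skew_relations"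
        by (intro rel_ideal_mult_right swap_power sr)
      then show ?thesis
        by (simp add: b g mult.assoc left_diff_distrib pscale_mult_left [symmetric])
    qed (simp add: pscale.subspace_0 [OF rel_ideal_subspace] mult.assoc)
  qed (simp_all add: lin_lin_ext)
  then show ?thesis
    by blast
qed

lemma polynomial_algebra_simps [simp]:
  "carrier polynomial_algebra = UNIV" "monoid.mult polynomial_algebra = (*)" "one polynomial_algebra = 1"
  "zero polynomial_algebra = 0" "add polynomial_algebra = (+)" "module.smult polynomial_algebra = Polynomial.smult"
  "component polynomial_algebra n = range (\<lambda>c. Polynomial.monom c n)"
  by (simp_all add: polynomial_algebra_def)

lemma polynomial_algebra_ring: "ring (polynomial_algebra :: ('k::field, 'k poly) graded_algebra)"
proof (rule ringI)
  show "abelian_group (polynomial_algebra :: ('k, 'k poly) graded_algebra)"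
    by (rule abelian_groupI) (auto simp: add_ac intro: exI [of _ "- _"])
  show "Group.monoid (polynomial_algebra :: ('k, 'k poly) graded_algebra)"
    by (rule monoidI) (auto simp: mult.assoc)
qed (auto simp: algebra_simps)

lemma polynomial_algebra_module:
  "module (scalars :: 'k::field ring) (polynomial_algebra :: ('k, 'k poly) graded_algebra)"
  by (rule moduleI)
    (auto intro: cring_from_type_algebra ring.is_abelian_group [OF polynomial_algebra_ring]
      simp: smult_add_left smult_add_right)

lemma polynomial_algebra_graded: "graded_algebra (polynomial_algebra :: ('k::field, 'k poly) graded_algebra)"
proof -
  let ?A = "polynomial_algebra :: ('k, 'k poly) graded_algebra"
  interpret A: module "scalars :: 'k ring" ?A
    by (rule polynomial_algebra_module)
  have inv: "\<ominus>\<^bsub>?A\<^esub> p = - p" for p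
    by (rule A.minus_equality) auto
  have finsum: "finsum ?A f D = sum f D" if "finite D" for f :: "nat \<Rightarrow> 'k poly" and D
    using that by induction (auto simp: A.finsum_empty A.finsum_insert)
  show ?thesis
  proof (intro graded_algebra.intro graded_algebra_axioms.intro polynomial_algebra_ring polynomial_algebra_module)
    show "submodule (component ?A n) (scalars :: 'k ring) ?A" for n
      by (rule A.submoduleI)
        (auto simp: inv add_monom smult_monom minus_monom intro: range_eqI [of _ _ 0])
    show "\<one>\<^bsub>?A\<^esub> \<in> component ?A 0"
      by (auto simp: monom_0 one_pCons)
  next
    fix p :: "'k poly"
    have fin: "finite {n. Polynomial.monom (Polynomial.coeff p n) n \<noteq> 0}"
      using MOST_coeff_eq_0 [of p] by (simp add: eventually_cofinite)
    show "\<exists>!f. (\<forall>n. f n \<in> component ?A n) \<and> finite {n. f n \<noteq> \<zero>\<^bsub>?A\<^esub>} \<and>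
        p = (\<Oplus>\<^bsub>?A\<^esub>n\<in>{n. f n \<noteq> \<zero>\<^bsub>?A\<^esub>}. f n)"
    proof (rule ex1I)
      let ?f = "\<lambda>n. Polynomial.monom (Polynomial.coeff p n) n"
      have "p = (\<Sum>n | ?f n \<noteq> 0. ?f n)"
        using fin by (intro poly_eqI) (auto simp: coeff_sum sum.delta)
      then show "(\<forall>n. ?f n \<in> component ?A n) \<and> finite {n. ?f n \<noteq> \<zero>\<^bsub>?A\<^esub>} \<and>
          p = (\<Oplus>\<^bsub>?A\<^esub>n\<in>{n. ?f n \<noteq> \<zero>\<^bsub>?A\<^esub>}. ?f n)"
        using fin by (auto simp: finsum)
    next
      fix f assume f: "(\<forall>n. f n \<in> component ?A n) \<and> finite {n. f n \<noteq> \<zero>\<^bsub>?A\<^esub>} \<and>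
          p = (\<Oplus>\<^bsub>?A\<^esub>n\<in>{n. f n \<noteq> \<zero>\<^bsub>?A\<^esub>}. f n)"
      then have "\<forall>n. \<exists>c. f n = Polynomial.monom c n"
        by auto
      then obtain c where c: "\<And>n. f n = Polynomial.monom (c n) n"
        by metis
      have "finite {n. c n \<noteq> 0}" "p = (\<Sum>n | c n \<noteq> 0. Polynomial.monom (c n) n)"
        using f by (auto simp: c finsum)
      then have "Polynomial.coeff p n = c n" for n
        by (auto simp: coeff_sum sum.delta)
      then show "f = (\<lambda>n. Polynomial.monom (Polynomial.coeff p n) n)"
        by (simp add: fun_eq_iff c)
    qed
  qed (auto simp: mult_monom)
qed

lemma polynomial_algebra_generated:
  "carrier polynomial_algebra \<subseteq> generated_submodule (polynomial_algebra :: ('k::field, 'k poly) graded_algebra)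
    (range (Polynomial.monom 1))"
  unfolding generated_submodule_def
proof safe
  fix p :: "'k poly" and N
  assume N: "submodule N (scalars :: 'k ring) (polynomial_algebra :: ('k, 'k poly) graded_algebra)"
    and M: "range (Polynomial.monom 1) \<subseteq> N"
  note N' = module.submoduleE [OF polynomial_algebra_module N]
  have monom: "Polynomial.monom c n \<in> N" for c n
    using N'(4) [of c "Polynomial.monom 1 n"] M by (auto simp: smult_monom)
  have "(\<Sum>n\<in>D. Polynomial.monom (Polynomial.coeff p n) n) \<in> N" if "finite D" for D
    using that by induction (use monom N'(5) monom [of 0 0] in auto)
  from this [of "{..degree p}"] show "p \<in> N"
    by (simp add: poly_as_sum_of_monoms)
qed

text \<open>
  Horner evaluation at an element of a noncommutative algebra. It is multiplicative because scalars
  are central and the powers of a single element commute.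
\<close>
definition poly_subst :: "('g, 'k::field) free_alg \<Rightarrow> 'k poly \<Rightarrow> ('g, 'k) free_alg" where
  "poly_subst x p = fold_coeffs (\<lambda>c q. scalar c + x * q) p 0"

lemma poly_subst_0 [simp]: "poly_subst x 0 = 0"
  by (simp add: poly_subst_def)

lemma poly_subst_pCons [simp]: "poly_subst x (pCons c p) = scalar c + x * poly_subst x p"
  by (cases "p = 0 \<and> c = 0") (auto simp: poly_subst_def scalar_def)

lemma poly_subst_add: "poly_subst x (p + q) = poly_subst x p + poly_subst x q"
  by (induction p q rule: poly_induct2) (simp_all add: scalar_def single_add algebra_simps)

lemma poly_subst_smult: "poly_subst x (Polynomial.smult c p) = pscale c (poly_subst x p)"
  by (induction p) (simp_all add: scalar_def pscale.scale_right_distrib pscale_mult_right)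

lemma poly_subst_mult: "poly_subst x (p * q) = poly_subst x p * poly_subst x q"
  by (induction p)
    (simp_all add: poly_subst_add poly_subst_smult distrib_right mult.assoc scalar_times, simp add: scalar_def)

lemma poly_subst_monom: "poly_subst x (Polynomial.monom c n) = pscale c (x ^ n)"
  by (induction n) (simp_all add: monom_0 monom_Suc pscale_mult_right scalar_def flip: single_one)

section \<open>The twisted tensor product\<close>

lemma linear_iso_P_class_coords:
  assumes "a \<noteq> 1"
  shows "linear_iso (P_algebra a) (free_space UNIV) (P_class_coords a)"
proof -
  have "surj (P_coords a)"
    by (rule surjI) (rule P_coords_lin_ext_basis)
  then have "bij_betw (P_class_coords a) (range (cls (P_relations a))) UNIV"
    by (auto simp: bij_betw_def inj_on_def image_image P_class_coords_cls [OF assms] P_coords_eq_iff [OF assms])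
  then show ?thesis
    by (auto simp: linear_iso_def P_algebra_def presented_algebra_simps P_class_coords_cls [OF assms]
        lin_add [OF lin_P_coords] lin_scale [OF lin_P_coords])
qed

fun skew_to_P :: "rs \<Rightarrow> (rst, 'k::field) free_alg" where
  "skew_to_P Skew_r = gen Gen_r"
| "skew_to_P Skew_s = gen Gen_s"

text \<open>
  The products of the images of \<open>r\<^sup>i s\<^sup>j\<close> and \<open>t\<^sup>k\<close> are the monomials, hence a basis of
  \<open>P(a)\<close>. Both inclusions are injective because they send spanning monomials to distinct basis
  elements.
\<close>
lemma P_twisted_tensor_product:
  fixes a :: "'k::field"
  assumes a: "a \<noteq> 1"
  shows "P_is_twisted_tensor_product a"
proof -
  let ?A = "skew_polynomial_algebra :: ('k, (rs, 'k) free_alg set) graded_algebra"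
  let ?B = "polynomial_algebra :: ('k, 'k poly) graded_algebra" and ?C = "P_algebra a"
  let ?R = "P_relations a"
  define iA where "iA = presented_hom ?R skew_to_P"
  define iB where "iB p = cls ?R (poly_subst (gen Gen_t) p)" for p
  have skew_rel: "subst skew_to_P p \<in> rel_ideal ?R" if "p \<in> skew_relations" for p
    using that P_relations_ideal [of _ a] by (simp add: skew_relations_def subst_add subst_mult)
  note iA_cls = presented_hom_cls [of skew_relations skew_to_P ?R, OF skew_rel, folded iA_def]
  note simps = skew_polynomial_algebra_def P_algebra_def presented_algebra_simps
  have skew_gen: "homogeneous 1 (skew_to_P g :: (rst, 'k) free_alg)" for g
    by (cases g) (simp_all only: skew_to_P.simps homogeneous_gen)
  have iA_hom: "iA \<in> graded_algebra_hom ?A ?C"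
    unfolding iA_def skew_polynomial_algebra_def P_algebra_def
    by (rule presented_hom_graded_algebra_hom) (rule skew_rel skew_gen, assumption?)+
  have skew_basis: "subst skew_to_P (skew_basis (i, j)) * gen Gen_t ^ k = (P_basis ((i, j), k) :: (rst, 'k) free_alg)"
    for i j k
    by (simp add: subst_mult subst_power)
  have iA_inj: "inj_on iA (carrier ?A)"
  proof (rule inj_onI)
    fix x y assume xy: "x \<in> carrier ?A" "y \<in> carrier ?A" "iA x = iA y"
    have "\<exists>v. x = cls skew_relations (lin_ext skew_basis v)" if "x \<in> carrier ?A" for x
      using that skew_spanning by (auto simp: simps cls_eq_iff)
    then obtain v w where v: "x = cls skew_relations (lin_ext skew_basis v)"
        and w: "y = cls skew_relations (lin_ext skew_basis w)"
      using xy by metis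
    (* The coordinates of the image of a combination of the monomials in r and s are its
       coefficients, placed at the indices with exponent 0 of t. *)
    define emb :: "(nat \<times> nat \<Rightarrow>\<^sub>0 'k) \<Rightarrow> _" where "emb = lin_ext (\<lambda>b. Poly_Mapping.single (b, 0 :: nat) 1)"
    have emb: "P_coords a (subst skew_to_P (lin_ext skew_basis v)) = emb v" for v
    proof (rule lin_eqI [of "\<lambda>v. P_coords a (subst skew_to_P (lin_ext skew_basis v))" emb])
      show "lin (\<lambda>v. P_coords a (subst skew_to_P (lin_ext skew_basis v)))"
        by (rule lin_comp [OF lin_comp [OF lin_lin_ext lin_subst] lin_P_coords])
      show "lin emb"
        by (simp add: emb_def lin_lin_ext)
      show "P_coords a (subst skew_to_P (lin_ext skew_basis (Poly_Mapping.single b 1))) = emb (Poly_Mapping.single b 1)" for b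
        using skew_basis [of "fst b" "snd b" 0] by (simp add: emb_def del: P_basis.simps skew_basis.simps)
    qed
    have "lin_ext (\<lambda>b. Poly_Mapping.single (fst b) 1) (emb v) = v" for v
      by (rule lin_eqI [of "\<lambda>v. lin_ext (\<lambda>b. Poly_Mapping.single (fst b) 1) (emb v)" "\<lambda>v. v"])
        (unfold emb_def, rule lin_comp [OF lin_lin_ext lin_lin_ext], rule lin_id, simp)
    moreover have "emb v = emb w"
      using xy(3) by (simp add: v w iA_cls emb flip: P_coords_eq_iff [OF a])
    ultimately show "x = y"
      unfolding v w by metis
  qed
  have iB_hom: "iB \<in> graded_algebra_hom ?B ?C"
    unfolding graded_algebra_hom_def
    by (auto intro!: ring_hom_memI homogeneous_pscale homogeneous_power homogeneous_gen imageI
        simp: iB_def simps poly_subst_add poly_subst_mult poly_subst_smult poly_subst_monom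
          one_pCons scalar_def single_one)
  have iB_inj: "inj_on iB (carrier ?B)"
  proof (rule inj_onI)
    fix p q :: "'k poly" assume "iB p = iB q"
    then have "P_coords a (poly_subst (gen Gen_t) p) = P_coords a (poly_subst (gen Gen_t) q)"
      by (simp add: iB_def P_coords_eq_iff [OF a])
    moreover have "Poly_Mapping.lookup (P_coords a (poly_subst (gen Gen_t) p)) ((0, 0), n) = Polynomial.coeff p n" for p n
    proof -
      have t: "P_coords a (gen Gen_t ^ n) = Poly_Mapping.single ((0, 0), n) 1" for n
        using P_coords_basis [of a "((0, 0), n)"] by simp
      have "Poly_Mapping.lookup (P_coords a (poly_subst (gen Gen_t) (\<Sum>i\<in>D. Polynomial.monom (c i) i))) ((0, 0), n)
          = Polynomial.coeff (\<Sum>i\<in>D. Polynomial.monom (c i) i) n" if "finite D" for D c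
        using that by induction
          (simp_all add: lin_zero [OF lin_P_coords] poly_subst_add lin_add [OF lin_P_coords] lookup_add
            poly_subst_monom lin_scale [OF lin_P_coords] t lookup_single when_def)
      from this [of "{..degree p}" "Polynomial.coeff p"] show ?thesis
        by (simp add: poly_as_sum_of_monoms)
    qed
    ultimately show "p = q"
      by (metis poly_eqI)
  qed
  have "\<exists>\<phi>. linear_iso (tensor_product ?A ?B) ?C \<phi> \<and>
      (\<forall>x\<in>carrier ?A. \<forall>p\<in>carrier ?B. \<phi> (pure_tensor ?A ?B x p) = iA x \<otimes>\<^bsub>?C\<^esub> iB p)"
  proof (rule tensor_product_iso_if_basis
      [where u = "\<lambda>b. cls skew_relations (skew_basis b)" and w = "Polynomial.monom 1" and \<theta> = "P_class_coords a"])
    show "carrier ?A \<subseteq> generated_submodule ?A (range (\<lambda>b. cls skew_relations (skew_basis b)))"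
      unfolding skew_polynomial_algebra_def by (rule presented_algebra_generated [OF skew_spanning])
    show "P_class_coords a (iA (cls skew_relations (skew_basis b)) \<otimes>\<^bsub>?C\<^esub> iB (Polynomial.monom 1 k))
        = Poly_Mapping.single (b, k) 1" for b k
      using skew_basis [of "fst b" "snd b" k]
      by (simp add: simps iA_cls iB_def poly_subst_monom P_class_coords_cls [OF a]
          del: P_basis.simps skew_basis.simps)
  qed (auto simp: simps iA_cls iB_def poly_subst_add poly_subst_smult subst_add subst_pscale
      distrib_left distrib_right pscale_mult_left [symmetric] pscale_mult_right [symmetric]
      presented_algebra_module polynomial_algebra_module polynomial_algebra_generated [simplified]
      linear_iso_P_class_coords [OF a, unfolded P_algebra_def])
  moreover have "graded_algebra ?A"
    unfolding skew_polynomial_algebra_def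
    by (rule presented_algebra_graded)
      (auto simp: skew_relations_def intro!: exI [of _ 2] homogeneous_add homogeneous_mult_linear homogeneous_gen)
  moreover have "graded_algebra ?C"
    unfolding P_algebra_def
  proof (rule presented_algebra_graded)
    fix p assume "p \<in> ?R"
    then have "homogeneous 2 p"
      by (auto simp: P_relations_def Let_def scalar_times power2_eq_square
          intro!: homogeneous_add homogeneous_diff homogeneous_pscale homogeneous_mult_linear homogeneous_gen)
    then show "\<exists>n. homogeneous n p" ..
  qed
  ultimately have "graded_twisted_tensor_product ?A ?B ?C iA iB"
    using iA_hom iA_inj iB_hom iB_inj polynomial_algebra_graded
    by (simp add: graded_twisted_tensor_product_def graded_algebra_inclusion_def)
  moreover have "iA (gen_class skew_relations Skew_r) = gen_class ?R Gen_r"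
      "iA (gen_class skew_relations Skew_s) = gen_class ?R Gen_s"
    by (simp_all add: gen_class_cls iA_cls)
  moreover have "iB (Polynomial.monom 1 1) = gen_class ?R Gen_t"
    by (simp add: iB_def gen_class_cls poly_subst_monom)
  ultimately show ?thesis
    unfolding P_is_twisted_tensor_product_def by blast
qed

theorem theorem1p4:
  fixes c :: "'k::{alg_closed_field, field_char_0}"
  assumes "type_EC c"
  shows "\<exists>a. a \<noteq> 0 \<and> a \<noteq> 1 \<and> P_is_twisted_tensor_product a \<and> graded_isomorphic (S11_algebra c) (P_algebra a)"
proof -
  obtain d e where *: "c ^ 3 = (1 + e) * (1 - e)" "d ^ 2 = - ((3 - e) * (1 + e))"
    "c \<noteq> 0" "d \<noteq> 0" "e \<noteq> 0" "3 + e \<noteq> 0" "3 - e \<noteq> 0" "1 + e \<noteq> 0" "1 - e \<noteq> 0"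
    using type_EC_parameters [OF assms] by metis
  define a where "a = (3 + e) ^ 3 * (1 - e) / ((3 - e) ^ 3 * (1 + e))"
  have a: "(3 - e) ^ 3 * (1 + e) * a = (3 + e) ^ 3 * (1 - e)"
    using * by (simp add: a_def)
  have "a \<noteq> 0"
    using * by (simp add: a_def)
  moreover have "a \<noteq> 1"
  proof
    assume "a = 1"
    then have "16 * e ^ 3 = 0"
      using a by Groebner_Basis.algebra
    then show False
      using * by simp
  qed
  ultimately show ?thesis
    using P_twisted_tensor_product S11_P_isomorphic [OF *(1,2) a *(3-8)] by blast
qed

end
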